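(* Let $\mathcal{X}$ be a Polish space, let $\lambda=(\lambda_1,\lambda_2,\ldots)\in\Lambda^\infty$, and let $P$ be the distribution of a $\lambda$-exchangeable sequence $(X_1,X_2,\ldots)$ on $\mathcal{X}^\infty$. Assume that the $\lambda_i$ are bounded continuous functions such that $$r_i:=\frac{\inf_{x\in\mathcal{X}}\lambda_i(x)}{\sup_{x\in\mathcal{X}}\lambda_i(x)}>0\ \text{ for } i=1,2,\ldots,\quad\text{and}\quad \sum_{i=1}^\infty(1-r_i)<\infty.$$ Then $P$ is a mixture of weighted i.i.d. distributions on $\mathcal{X}^\infty$ (with respect to the weights $\lambda$).
   Context: $\Lambda$ is the set of measurable functions $\mathcal{X}\to(0,\infty)$, with $\Lambda^n$, $\Lambda^\infty$ the $n$-fold and countably infinite products. $\mathcal{B}$ is the Borel $\sigma$-algebra of $\mathcal{X}$, and $\mathcal{B}^n$, $\mathcal{B}^\infty$ are the Borel $\sigma$-algebras of $\mathcal{X}^n$, $\mathcal{X}^\infty$. A probability measure $P_n$ on $(\mathcal{X}^n,\mathcal{B}^n)$ is called $(\lambda_1,\ldots,\lambda_n)$-exchangeable if the measure $\overline{P}_n$ defined by $\overline{P}_n(B)=\int_B \frac{dP_n(x_1,\ldots,x_n)}{\prod_{i=1}^n\lambda_i(x_i)}$, $B\in\mathcal{B}^n$, is an exchangeable probability measure (i.e. invariant under all permutations of the $n$ coordinates). A probability measure $P$ on $(\mathcal{X}^\infty,\mathcal{B}^\infty)$ (or a random sequence with this distribution) is called $\lambda$-exchangeable, for $\lambda=(\lambda_1,\lambda_2,\ldots)\in\Lambda^\infty$,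 if for every $n\ge1$ its marginal $P_n$ on the first $n$ coordinates is $(\lambda_1,\ldots,\lambda_n)$-exchangeable. For a probability measure $\mu$ on $\mathcal{X}$ and a bounded $\lambda_i\in\Lambda$, let $T_i\mu$ be the probability measure $T_i\mu(dx)=\lambda_i(x)\mu(dx)/\int\lambda_i\,d\mu$. A weighted i.i.d. distribution on $\mathcal{X}^\infty$ is a product measure $\otimes_{i=1}^\infty T_i\mu$. A mixture of weighted i.i.d. distributions on $\mathcal{X}^\infty$ is a measure of the form $\int_{\mathcal{P}(\mathcal{X})}\otimes_{i=1}^\infty T_i\mu\,\Pi(d\mu)$ with $\Pi$ a probability measure on the space $\mathcal{P}(\mathcal{X})$ of probability measures on $\mathcal{X}$ (with the Borel $\sigma$-algebra of the weak topology). *)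

theory Defs
  imports "HOL-Probability.Probability"
begin

text \<open>
  Coordinates and weights are numbered from 0: the weight \<open>l i\<close> belongs to coordinate \<open>i\<close>,
  and the first \<open>n\<close> coordinates are those in \<open>{..<n}\<close>.  The underlying type is a
  Polish space, so the product \<open>\<sigma>\<close>-algebras \<open>seq_borel n\<close> and \<open>seq_borel_inf\<close> are the Borel
  \<open>\<sigma>\<close>-algebras of the corresponding product spaces (for sequences, see
  \<open>sets_PiM_equal_borel\<close>).
\<close>

abbreviation seq_borel :: "nat \<Rightarrow> (nat \<Rightarrow> 'a::polish_space) measure" where
  "seq_borel n \<equiv> (\<Pi>\<^sub>M i\<in>{..<n}. borel)"

abbreviation seq_borel_inf :: "(nat \<Rightarrow> 'a::polish_space) measure" where
  "seq_borel_inf \<equiv> (\<Pi>\<^sub>M i\<in>UNIV. borel)"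

definition weights :: "('a::polish_space \<Rightarrow> real) set" where
  "weights = {f. f \<in> borel_measurable borel \<and> (\<forall>x. 0 < f x)}"

definition exchangeable :: "nat \<Rightarrow> (nat \<Rightarrow> 'a::polish_space) measure \<Rightarrow> bool" where
  "exchangeable n M \<longleftrightarrow>
     sets M = sets (seq_borel n) \<and> prob_space M \<and>
     (\<forall>\<pi>. \<pi> permutes {..<n} \<longrightarrow> distr M (seq_borel n) (\<lambda>x. \<lambda>i\<in>{..<n}. x (\<pi> i)) = M)"

definition unweighted ::
  "(nat \<Rightarrow> 'a::polish_space \<Rightarrow> real) \<Rightarrow> nat \<Rightarrow> (nat \<Rightarrow> 'a) measure \<Rightarrow> (nat \<Rightarrow> 'a) measure" where
  "unweighted l n Pn = density Pn (\<lambda>x. ennreal (1 / (\<Prod>i<n. l i (x i))))"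

text \<open>
  The reweighted measure is required to be an exchangeable \<^emph>\<open>probability\<close> measure.  This fixes the
  normalisation of the weights; rescaling each weight by a positive constant changes neither
  \<open>weight_ratio\<close> nor \<open>tilt\<close> below.
\<close>

definition weighted_exchangeable_n ::
  "(nat \<Rightarrow> 'a::polish_space \<Rightarrow> real) \<Rightarrow> nat \<Rightarrow> (nat \<Rightarrow> 'a) measure \<Rightarrow> bool" where
  "weighted_exchangeable_n l n Pn \<longleftrightarrow>
     sets Pn = sets (seq_borel n) \<and> prob_space Pn \<and> exchangeable n (unweighted l n Pn)"

definition marginal :: "nat \<Rightarrow> (nat \<Rightarrow> 'a::polish_space) measure \<Rightarrow> (nat \<Rightarrow> 'a) measure" where
  "marginal n P = distr P (seq_borel n) (\<lambda>x. restrict x {..<n})"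

definition weighted_exchangeable ::
  "(nat \<Rightarrow> 'a::polish_space \<Rightarrow> real) \<Rightarrow> (nat \<Rightarrow> 'a) measure \<Rightarrow> bool" where
  "weighted_exchangeable l P \<longleftrightarrow>
     sets P = sets seq_borel_inf \<and> prob_space P \<and>
     (\<forall>n\<ge>1. weighted_exchangeable_n l n (marginal n P))"

definition weight_ratio :: "('a::polish_space \<Rightarrow> real) \<Rightarrow> real" where
  "weight_ratio f = (INF x. f x) / (SUP x. f x)"

definition tilt :: "('a::polish_space \<Rightarrow> real) \<Rightarrow> 'a measure \<Rightarrow> 'a measure" where
  "tilt f \<mu> = density \<mu> (\<lambda>x. ennreal (f x / (\<integral>y. f y \<partial>\<mu>)))"

definition weighted_iid ::
  "(nat \<Rightarrow> 'a::polish_space \<Rightarrow> real) \<Rightarrow> 'a measure \<Rightarrow> (nat \<Rightarrow> 'a) measure" where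
  "weighted_iid l \<mu> = (\<Pi>\<^sub>M i\<in>UNIV. tilt (l i) \<mu>)"

definition prob_measures :: "'a::polish_space measure set" where
  "prob_measures = {\<mu>. sets \<mu> = sets borel \<and> prob_space \<mu>}"

definition weak_topology :: "'a::polish_space measure topology" where
  "weak_topology = topology_generated_by
     {{\<mu> \<in> prob_measures. (\<integral>x. f x \<partial>\<mu>) \<in> U} | (f :: 'a \<Rightarrow> real) U.
        continuous_on UNIV f \<and> bounded (range f) \<and> open U}"

definition weak_borel :: "'a::polish_space measure measure" where
  "weak_borel = sigma prob_measures {U. openin weak_topology U}"

lemma topspace_weak_topology: "topspace weak_topology = (prob_measures :: 'a::polish_space measure set)"
proof -
  let ?S = "{{\<mu> \<in> prob_measures. (\<integral>x. f x \<partial>\<mu>) \<in> U} | (f :: 'a \<Rightarrow> real) U.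
    continuous_on UNIV f \<and> bounded (range f) \<and> open U}"
  have "{\<mu> \<in> prob_measures. (\<integral>x. (\<lambda>_::'a. 0::real) x \<partial>\<mu>) \<in> UNIV} \<in> ?S"
    by (rule CollectI, rule exI[of _ "\<lambda>_. 0"], rule exI[of _ UNIV]) simp
  then have "prob_measures \<in> ?S"
    by (simp only: UNIV_I simp_thms Collect_mem_eq)
  then have "prob_measures \<subseteq> \<Union>?S"
    by (rule Union_upper)
  moreover have "\<Union>?S \<subseteq> prob_measures"
    by blast
  ultimately show ?thesis
    unfolding weak_topology_def topology_generated_by_topspace by (rule antisym[rotated])
qed

lemma sets_weak_borel:
  "sets weak_borel = sigma_sets prob_measures {U. openin weak_topology U}"
proof -
  have "{U. openin weak_topology U} \<subseteq> Pow (prob_measures :: 'a measure set)"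
    using openin_subset topspace_weak_topology by blast
  then show ?thesis
    unfolding weak_borel_def by (rule sets_measure_of)
qed

text \<open>
  The integral of measures is taken setwise.  Measurability of the integrand is demanded because
  the nonnegative integral of a non-measurable function is only a lower integral.
\<close>

definition weighted_iid_mixture ::
  "(nat \<Rightarrow> 'a::polish_space \<Rightarrow> real) \<Rightarrow> (nat \<Rightarrow> 'a) measure \<Rightarrow> bool" where
  "weighted_iid_mixture l P \<longleftrightarrow>
     sets P = sets seq_borel_inf \<and>
     (\<exists>Q. sets Q = sets weak_borel \<and> prob_space Q \<and>
        (\<forall>A \<in> sets seq_borel_inf.
           (\<lambda>\<mu>. emeasure (weighted_iid l \<mu>) A) \<in> borel_measurable Q \<and>
           emeasure P A = (\<integral>\<^sup>+ \<mu>. emeasure (weighted_iid l \<mu>) A \<partial>Q)))"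

end

theory Submission
  imports Defs
begin

text \<open>
  The theorem reduces to de Finetti's theorem for exchangeable sequences by one change of measure.

  Divide each weight by its supremum, \<open>w i = l i / Sup (l i)\<close>; this changes neither the tilted measures
  nor, up to a constant, the reweighted marginals.  Since \<open>weight_ratio (l i) \<le> w i x \<le> 1\<close> and the defects
  \<open>1 - weight_ratio (l i)\<close> are summable, the infinite product \<open>G \<omega> = (\<Prod>i. w i (\<omega> i))\<close> converges and
  stays between a positive constant and \<open>1\<close>.  For a permutation of the first \<open>n\<close> coordinates the
  hypothesis says that the measures with density \<open>1 / (\<Prod>i<k. w i (\<omega> i))\<close> with respect to \<open>P\<close> are, for
  \<open>k \<ge> n\<close>, invariant on events that depend on the first \<open>k\<close> coordinates.  Letting \<open>k\<close> tend to infinity,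
  the normalised measure with density proportional to \<open>1 / G\<close> is an exchangeable probability measure
  \<open>Q\<close> (\<open>exchangeable_reweighted\<close>), hence a mixture of measures \<open>\<mu>\<^sup>\<infinity>\<close> (\<open>de_Finetti\<close>).  Multiplying by \<open>G\<close>
  recovers \<open>P\<close>, and because \<open>G\<close> is a product over the coordinates, \<open>G\<close> times \<open>\<mu>\<^sup>\<infinity>\<close> is a constant
  \<open>Z \<mu>\<close> times the product of the tilted measures (\<open>total_weight_density_iid\<close>).  The constants \<open>Z \<mu>\<close>
  are absorbed into the mixing measure (\<open>weighted_iid_mixture_of_symmetric\<close>).

  De Finetti's theorem is proved by means of empirical frequencies.  Exchangeability makes the frequencies
  of a Borel set \<open>B\<close> among the first \<open>4 ^ k\<close> coordinates an almost surely convergent sequence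
  (\<open>AE_convergent_freq\<close>).  On a countable algebra that generates the Borel sets the limits define
  a finitely additive set function for almost every \<open>\<omega>\<close>; inner regularity of the one-dimensional marginal
  makes it countably additive, and Caratheodory's theorem extends it to a random measure \<open>\<kappa> \<omega>\<close>
  (\<open>directing_measure_exists\<close>).  Finally, coordinates are replaced one at a time by \<open>\<kappa> \<omega>\<close>: a coordinate can
  be exchanged with any far away one, hence with an average over many of them
  (\<open>emeasure_cylinder_eq_\<kappa>\<close>).

  The mixing measure has to live on the Borel sets of the weak topology.  On a Polish space these are
  generated by the evaluations \<open>\<mu> \<mapsto> \<mu> B\<close> (\<open>sets_weak_borel_eq_prob_algebra\<close>), so the measurable
  structure \<open>prob_algebra borel\<close> can be used throughout.
\<close>

section \<open>The Borel sets of the weak topology\<close>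

text \<open>
  A countable family of bounded continuous functions from which every bounded continuous function can be
  recovered as a supremum of minorants: cones \<open>q - m * dist z x\<close> with rational height \<open>q\<close>, integral
  slope \<open>m\<close> and apex \<open>z\<close> in a countable dense set, cut off below at \<open>- M\<close>.
\<close>

lemma exists_countable_minorants:
  "\<exists>h :: nat \<Rightarrow> 'a::polish_space \<Rightarrow> real.
     (\<forall>i. continuous_on UNIV (h i) \<and> bounded (range (h i))) \<and>
     (\<forall>f x t. continuous_on UNIV f \<longrightarrow> bounded (range f) \<longrightarrow> t < f x \<longrightarrow>
       (\<exists>i. (\<forall>y. h i y \<le> f y) \<and> t < h i x))"
proof -
  obtain D :: "'a set" where D: "countable D" "\<And>Y. open Y \<Longrightarrow> Y \<noteq> {} \<Longrightarrow> \<exists>d\<in>D. d \<in> Y"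
    by (erule countable_dense_setE)
  define H where "H = (\<lambda>(z::'a, q::real, m::nat, M::nat). \<lambda>x. max (- real M) (q - real m * dist z x))"
  define I where "I = D \<times> (\<rat> :: real set) \<times> (UNIV :: nat set) \<times> (UNIV :: nat set)"
  have "D \<noteq> {}" using D(2)[of UNIV] by auto
  have I: "countable I" "I \<noteq> {}"
    using D(1) \<open>D \<noteq> {}\<close> by (auto simp: I_def countable_rat intro!: countable_SIGMA exI[of _ 0])
  have 1: "continuous_on UNIV (H p)" for p
    by (cases p) (auto simp: H_def intro!: continuous_intros)
  have 2: "bounded (range (H p))" for p
  proof -
    obtain z q m M where p: "p = (z, q, m, M)" by (cases p)
    have "\<bar>H p x\<bar> \<le> real M + \<bar>q\<bar>" for x
    proof -
      have "0 \<le> real m * dist z x" by simp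
      then have "H p x \<le> real M + \<bar>q\<bar>" unfolding p H_def by (auto intro: order_trans[of _ q])
      moreover have "- (real M + \<bar>q\<bar>) \<le> H p x" unfolding p H_def by (auto simp: le_max_iff_disj)
      ultimately show ?thesis by (auto simp: abs_le_iff)
    qed
    then show ?thesis by (auto simp: bounded_iff)
  qed
  have 3: "\<exists>p\<in>I. (\<forall>y. H p y \<le> f y) \<and> t < H p x"
    if f: "continuous_on UNIV f" "bounded (range f)" and t: "t < f x" for f x t
  proof -
    obtain B where B: "\<And>y. \<bar>f y\<bar> \<le> B" using f(2) by (auto simp: bounded_iff)
    obtain M :: nat where "B \<le> real M" using real_arch_simple by blast
    with B have M: "- real M \<le> f y" for y using B[of y] by linarith
    obtain q where q: "q \<in> \<rat>" "t < q" "q < f x" using t Rats_dense_in_real by blast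
    have "isCont f x" using f(1) by (simp add: continuous_on_eq_continuous_at)
    then have "\<forall>\<^sub>F y in nhds x. q < f y"
      using q(3) by (metis isCont_def order_tendstoD(1) tendsto_at_iff_tendsto_nhds)
    then obtain d where d: "0 < d" "\<And>y. dist y x < d \<Longrightarrow> q < f y"
      by (auto simp: eventually_nhds_metric)
    obtain m :: nat where "(q + real M) / (d / 2) \<le> real m" using real_arch_simple by blast
    then have m: "q + real M \<le> real m * (d / 2)" using d(1) by (simp add: field_simps)
    \<comment> \<open>An apex within \<open>e\<close> of \<open>x\<close> leaves the cone above \<open>t\<close> at \<open>x\<close> and at least \<open>d / 2\<close> away from every point outside the ball of radius \<open>d\<close>, where the cut-off value has been reached.\<close>
    define e where "e = min (d / 2) ((q - t) / (real m + 1))"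
    have e: "0 < e" using d(1) q(2) by (simp add: e_def)
    obtain z where z: "z \<in> D" "dist x z < e"
      using D(2)[of "ball x e"] e by auto
    have "dist z x < (q - t) / (real m + 1)" using z(2) by (simp add: e_def dist_commute)
    then have "dist z x * (real m + 1) < q - t" by (simp add: pos_less_divide_eq)
    moreover have "real m * dist z x \<le> dist z x * (real m + 1)" by (simp add: algebra_simps)
    ultimately have "t < q - real m * dist z x" by linarith
    then have gt: "t < H (z, q, m, M) x" by (simp add: H_def less_max_iff_disj)
    have le: "H (z, q, m, M) y \<le> f y" for y
    proof (cases "dist y x < d")
      case True
      have "0 \<le> real m * dist z y" by simp
      then have "q - real m * dist z y \<le> f y" using d(2)[OF True] by linarith
      with M[of y] show ?thesis by (simp add: H_def)
    next
      case False
      have "dist x z < d / 2" using z(2) by (simp add: e_def)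
      with False have "d / 2 \<le> dist z y"
        using dist_triangle[of y x z] by (simp add: dist_commute)
      then have "real m * (d / 2) \<le> real m * dist z y" by (intro mult_left_mono) auto
      with m M[of y] show ?thesis by (simp add: H_def)
    qed
    from gt le z(1) q(1) show ?thesis by (intro bexI[of _ "(z, q, m, M)"]) (auto simp: I_def)
  qed
  have 4: "\<exists>i. (\<forall>y. H (from_nat_into I i) y \<le> f y) \<and> t < H (from_nat_into I i) x"
    if "continuous_on UNIV f" "bounded (range f)" "t < f x" for f x t
    using 3[OF that] from_nat_into_to_nat_on[OF I(1)] by metis
  show ?thesis
    by (rule exI[of _ "\<lambda>i. H (from_nat_into I i)"]) (use 1 2 4 in blast)
qed

lemma prob_measures_eq_space: "(prob_measures :: 'a::polish_space measure set) = space (prob_algebra borel)"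
  by (auto simp: prob_measures_def space_prob_algebra)

text \<open>
  By dominated convergence the integral of \<open>f\<close> is the limit of the integrals of maxima of finitely many
  minorants.  Hence the condition \<open>p < \<integral>f d\<mu>\<close>, a condition on one of uncountably many functions \<open>f\<close>, is a
  union of conditions from a countable list.
\<close>

lemma integral_gt_imp_finite_minorant:
  fixes h :: "nat \<Rightarrow> 'a::polish_space \<Rightarrow> real"
  assumes h: "\<And>i. continuous_on UNIV (h i)" "\<And>i. bounded (range (h i))"
    and dense: "\<And>x t. t < f x \<Longrightarrow> \<exists>i. (\<forall>y. h i y \<le> f y) \<and> t < h i x"
    and f: "continuous_on UNIV f" "bounded (range f)"
    and \<mu>: "\<mu> \<in> prob_measures" and p: "p < (\<integral>x. f x \<partial>\<mu>)"
  shows "\<exists>F. finite F \<and> F \<noteq> {} \<and> (\<forall>y. (MAX i\<in>F. h i y) \<le> f y) \<and> p < (\<integral>x. (MAX i\<in>F. h i x) \<partial>\<mu>)"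
proof -
  interpret prob_space \<mu> using \<mu> by (simp add: prob_measures_def)
  have [measurable_cong]: "sets \<mu> = sets borel" using \<mu> by (simp add: prob_measures_def)
  have [measurable]: "h i \<in> borel_measurable borel" for i
    by (intro borel_measurable_continuous_onI h)
  have [measurable]: "f \<in> borel_measurable borel"
    by (intro borel_measurable_continuous_onI f)
  define I where "I = {i. \<forall>y. h i y \<le> f y}"
  have "I \<noteq> {}" using dense[of "f undefined - 1" undefined] by (auto simp: I_def)
  define e where "e = from_nat_into I"
  have e: "range e = I" unfolding e_def by (rule range_from_nat_into) (use \<open>I \<noteq> {}\<close> in auto)
  define g where "g n x = (MAX i\<in>e ` {..n}. h i x)" for n x
  have g_le: "g n x \<le> f x" for n x
  proof -
    have "e k \<in> I" for k using e by auto
    then have "h (e k) x \<le> f x" for k by (simp add: I_def)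
    then show ?thesis unfolding g_def by (subst Max_le_iff) auto
  qed
  have le_g: "h (e k) x \<le> g n x" if "k \<le> n" for k n x
    unfolding g_def using that by (intro Max_ge) auto
  obtain B where B: "\<And>x. \<bar>f x\<bar> \<le> B" using f(2) by (auto simp: bounded_iff)
  obtain C where C: "\<And>x. \<bar>h (e 0) x\<bar> \<le> C" using h(2)[of "e 0"] by (auto simp: bounded_iff)
  have g_bound: "norm (g n x) \<le> B + C" for n x
    using B[of x] C[of x] g_le[of n x] le_g[of 0 n x] by (auto simp: abs_if split: if_splits)
  have g_lim: "(\<lambda>n. g n x) \<longlonglongrightarrow> f x" for x
  proof (rule order_tendstoI)
    fix a assume "a < f x"
    then obtain i where "i \<in> I" "a < h i x" using dense[OF \<open>a < f x\<close>] by (auto simp: I_def)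
    then obtain k where "a < h (e k) x" using e by auto
    then show "\<forall>\<^sub>F n in sequentially. a < g n x"
      unfolding eventually_sequentially using le_g less_le_trans by blast
  next
    fix a assume "f x < a"
    then show "\<forall>\<^sub>F n in sequentially. g n x < a"
      using g_le le_less_trans by (intro always_eventually) blast
  qed
  have [measurable]: "g n \<in> borel_measurable borel" for n
    unfolding g_def by (rule borel_measurable_Max) auto
  have "(\<lambda>n. \<integral>x. g n x \<partial>\<mu>) \<longlonglongrightarrow> (\<integral>x. f x \<partial>\<mu>)"
    by (rule integral_dominated_convergence[where w="\<lambda>_. B + C"]) (use g_lim g_bound in auto)
  from order_tendstoD(1)[OF this p] obtain n where "p < (\<integral>x. g n x \<partial>\<mu>)"
    by (auto simp: eventually_sequentially)
  then show ?thesis using g_le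
    by (intro exI[of _ "e ` {..n}"]) (auto simp: g_def)
qed

lemma openin_weak_topology_integral:
  fixes f :: "'a::polish_space \<Rightarrow> real"
  assumes "continuous_on UNIV f" "bounded (range f)" "open U"
  shows "openin weak_topology {\<mu> \<in> prob_measures. (\<integral>x. f x \<partial>\<mu>) \<in> U}"
  unfolding weak_topology_def by (intro topology_generated_by_Basis CollectI exI[of _ f] exI[of _ U]) (use assms in auto)

text \<open>
  A weakly open set is an arbitrary union of basic open sets, so measurability needs a
  countable base.  It consists of the finite intersections of the sets
  \<open>{\<mu>. p < \<integral>g d\<mu>}\<close> for rational \<open>p\<close> and finite maxima \<open>g\<close> of the countable family of minorants.
\<close>

lemma weak_open_in_sets_prob_algebra:
  assumes "openin weak_topology U"
  shows "U \<in> sets (prob_algebra (borel :: 'a::polish_space measure))"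
proof -
  obtain h :: "nat \<Rightarrow> 'a::polish_space \<Rightarrow> real" where
    h: "\<And>i. continuous_on UNIV (h i)" "\<And>i. bounded (range (h i))"
    and dense: "\<And>f x t. continuous_on UNIV f \<Longrightarrow> bounded (range f) \<Longrightarrow> t < f x \<Longrightarrow>
       \<exists>i. (\<forall>y. h i y \<le> f y) \<and> t < h i x"
    using exists_countable_minorants by metis
  have h_meas[measurable]: "h i \<in> borel_measurable borel" for i
    by (intro borel_measurable_continuous_onI h)
  define S where "S F p = {\<mu> \<in> prob_measures. p < (\<integral>x. (MAX i\<in>F. h i x) \<partial>\<mu>)}" for F p
  define C where "C = (\<lambda>(F, p). S F p) ` ({F. finite F \<and> F \<noteq> {}} \<times> \<rat>)"
  have C_sets: "W \<in> sets (prob_algebra borel)" if "W \<in> C" for W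
  proof -
    from that have "\<exists>F p. finite F \<and> F \<noteq> {} \<and> W = S F p" by (auto simp: C_def)
    then obtain F p where F: "finite F" "F \<noteq> {}" and W: "W = S F p" by blast
    have [measurable]: "(\<lambda>x. MAX i\<in>F. h i x) \<in> borel_measurable borel"
      using F by (intro borel_measurable_Max) auto
    have "(\<lambda>\<mu>. \<integral>x. (MAX i\<in>F. h i x) \<partial>\<mu>) \<in> borel_measurable (prob_algebra borel)"
      unfolding prob_algebra_def
      by (intro measurable_restrict_space1 integral_measurable_subprob_algebra) measurable
    then show ?thesis unfolding W S_def prob_measures_eq_space by measurable
  qed
  have "countable {F :: nat set. finite F \<and> F \<noteq> {}}"
    by (rule countable_subset[OF _ countable_Collect_finite]) auto
  then have "countable C" by (auto simp: C_def countable_rat intro!: countable_SIGMA)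
  have basis: "\<exists>\<F>. finite \<F> \<and> \<F> \<subseteq> C \<and> \<mu> \<in> (\<Inter>\<F> \<inter> prob_measures) \<and> \<Inter>\<F> \<inter> prob_measures \<subseteq> U"
    if "openin weak_topology U" "\<mu> \<in> U" for \<mu> U
    using that(1) that(2) unfolding weak_topology_def openin_topology_generated_by_iff
  proof (induction arbitrary: \<mu> rule: generate_topology_on.induct)
    case (Int a b)
    then obtain F G where
      "finite F \<and> F \<subseteq> C \<and> \<mu> \<in> (\<Inter>F \<inter> prob_measures) \<and> \<Inter>F \<inter> prob_measures \<subseteq> a"
      "finite G \<and> G \<subseteq> C \<and> \<mu> \<in> (\<Inter>G \<inter> prob_measures) \<and> \<Inter>G \<inter> prob_measures \<subseteq> b"
      by (meson IntD1 IntD2)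
    then show ?case by (intro exI[of _ "F \<union> G"]) auto
  next
    case (UN K)
    then obtain k where k: "k \<in> K" "\<mu> \<in> k" by auto
    from UN.IH[OF k] obtain \<F> where
      "finite \<F>" "\<F> \<subseteq> C" "\<mu> \<in> \<Inter>\<F> \<inter> prob_measures" "\<Inter>\<F> \<inter> prob_measures \<subseteq> k" by auto
    with k(1) show ?case by (intro exI[of _ \<F>] conjI) auto
  next
    case (Basis s)
    then obtain f :: "'a \<Rightarrow> real" and V where s: "s = {\<mu> \<in> prob_measures. (\<integral>x. f x \<partial>\<mu>) \<in> V}"
      and f: "continuous_on UNIV f" "bounded (range f)" and V: "open V" by auto
    let ?I = "\<integral>x. f x \<partial>\<mu>"
    have \<mu>: "\<mu> \<in> prob_measures" and "?I \<in> V" using Basis s by auto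
    then obtain d where d: "0 < d" "\<And>y. \<bar>y - ?I\<bar> < d \<Longrightarrow> y \<in> V"
      using V by (auto simp: open_dist dist_real_def)
    obtain p where p: "p \<in> \<rat>" "?I - d < p" "p < ?I" using Rats_dense_in_real[of "?I - d" ?I] d by auto
    obtain q where q: "q \<in> \<rat>" "- ?I - d < q" "q < - ?I"
      using Rats_dense_in_real[of "- ?I - d" "- ?I"] d by auto
    have f': "continuous_on UNIV (\<lambda>x. - f x)" "bounded (range (\<lambda>x. - f x))"
      using f by (auto intro!: continuous_intros simp: bounded_iff)
    obtain F where F: "finite F" "F \<noteq> {}" "\<forall>y. (MAX i\<in>F. h i y) \<le> f y" "p < (\<integral>x. (MAX i\<in>F. h i x) \<partial>\<mu>)"
      using integral_gt_imp_finite_minorant[OF h dense[OF f] f \<mu> p(3)] by blast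
    have "q < (\<integral>x. - f x \<partial>\<mu>)" using q by simp
    then obtain G where G: "finite G" "G \<noteq> {}" "\<forall>y. (MAX i\<in>G. h i y) \<le> - f y" "q < (\<integral>x. (MAX i\<in>G. h i x) \<partial>\<mu>)"
      using integral_gt_imp_finite_minorant[OF h dense[OF f'] f' \<mu>] by blast
    have sub: "S F p \<inter> S G q \<subseteq> s"
    proof
      fix \<nu> assume "\<nu> \<in> S F p \<inter> S G q"
      then have \<nu>: "\<nu> \<in> prob_measures" "p < (\<integral>x. (MAX i\<in>F. h i x) \<partial>\<nu>)" "q < (\<integral>x. (MAX i\<in>G. h i x) \<partial>\<nu>)"
        by (auto simp: S_def)
      then interpret prob_space \<nu> by (simp add: prob_measures_def)
      have [measurable_cong]: "sets \<nu> = sets borel" using \<nu> by (simp add: prob_measures_def)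
      have int: "integrable \<nu> g" if "continuous_on UNIV g" "bounded (range g)" for g :: "'a \<Rightarrow> real"
      proof -
        from that(2) obtain K where "\<And>x. norm (g x) \<le> K" by (auto simp: bounded_iff)
        moreover have "g \<in> borel_measurable borel" by (intro borel_measurable_continuous_onI that)
        ultimately show ?thesis by (intro integrable_const_bound[where B=K]) auto
      qed
      have int_max: "integrable \<nu> (\<lambda>x. MAX i\<in>F. h i x)" if "finite F" "F \<noteq> {}" for F
        using that
      proof (induction rule: finite_ne_induct)
        case (insert i F)
        then have "(\<lambda>x. MAX j\<in>insert i F. h j x) = (\<lambda>x. max (h i x) (MAX j\<in>F. h j x))"
          by (subst image_insert, subst Max_insert) auto
        then show ?case by (simp only:) (intro integrable_max int h insert.IH)
      qed (auto intro!: int h)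
      have "(\<integral>x. (MAX i\<in>F. h i x) \<partial>\<nu>) \<le> (\<integral>x. f x \<partial>\<nu>)"
        by (intro integral_mono int_max int f F(3)[rule_format] F)
      moreover have "(\<integral>x. (MAX i\<in>G. h i x) \<partial>\<nu>) \<le> (\<integral>x. - f x \<partial>\<nu>)"
        by (intro integral_mono int_max int f' G(3)[rule_format] G)
      ultimately have "p < (\<integral>x. f x \<partial>\<nu>)" "q < - (\<integral>x. f x \<partial>\<nu>)" using \<nu> by auto
      with p q have "\<bar>(\<integral>x. f x \<partial>\<nu>) - ?I\<bar> < d" by (auto simp: abs_if)
      then show "\<nu> \<in> s" using d(2) \<nu> s by auto
    qed
    have "S F p \<in> C" unfolding C_def
      by (rule image_eqI[of _ _ "(F, p)"]) (use F p in auto)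
    moreover have "S G q \<in> C" unfolding C_def
      by (rule image_eqI[of _ _ "(G, q)"]) (use G q in auto)
    ultimately show ?case using sub F G \<mu>
      by (intro exI[of _ "{S F p, S G q}"]) (auto simp: S_def)
  qed auto
  define W where "W = {\<F>. finite \<F> \<and> \<F> \<subseteq> C \<and> \<Inter>\<F> \<inter> prob_measures \<subseteq> U}"
  have "countable W"
    by (rule countable_subset[OF _ countable_Collect_finite_subset[OF \<open>countable C\<close>]]) (auto simp: W_def)
  moreover have "\<Inter>\<F> \<inter> prob_measures \<in> sets (prob_algebra borel)" if "\<F> \<in> W" for \<F>
  proof -
    have "\<F> = {} \<or> \<Inter>\<F> \<in> sets (prob_algebra borel)"
      using that C_sets sets.finite_INT[of \<F> "\<lambda>W. W" "prob_algebra borel"] by (auto simp: W_def)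
    then show ?thesis unfolding prob_measures_eq_space by auto
  qed
  ultimately have "(\<Union>\<F>\<in>W. \<Inter>\<F> \<inter> prob_measures) \<in> sets (prob_algebra borel)"
    by (intro sets.countable_UN') auto
  also have "(\<Union>\<F>\<in>W. \<Inter>\<F> \<inter> prob_measures) = U"
  proof
    show "(\<Union>\<F>\<in>W. \<Inter>\<F> \<inter> prob_measures) \<subseteq> U" by (auto simp: W_def)
    show "U \<subseteq> (\<Union>\<F>\<in>W. \<Inter>\<F> \<inter> prob_measures)"
    proof
      fix \<mu> assume "\<mu> \<in> U"
      from basis[OF assms this] obtain \<F> where
        "finite \<F>" "\<F> \<subseteq> C" "\<mu> \<in> \<Inter>\<F> \<inter> prob_measures" "\<Inter>\<F> \<inter> prob_measures \<subseteq> U" by auto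
      then show "\<mu> \<in> (\<Union>\<F>\<in>W. \<Inter>\<F> \<inter> prob_measures)"
        by (intro UN_I[of \<F>]) (simp_all add: W_def)
    qed
  qed
  finally show ?thesis .
qed

text \<open>
  The indicator of an open set is the increasing limit of the continuous functions
  \<open>min 1 (m * infdist x (- U))\<close>.  The case of the whole space is separate because the distance to
  the empty set is \<open>0\<close> by convention.
\<close>

lemma borel_measurable_emeasure_weak_borel:
  fixes U :: "'a::polish_space set"
  assumes "open U"
  shows "(\<lambda>\<mu>. emeasure \<mu> U) \<in> borel_measurable weak_borel"
proof (cases "U = UNIV")
  case True
  have sp: "space weak_borel = (prob_measures :: 'a measure set)"
    unfolding weak_borel_def by (rule space_measure_of_conv)
  have "emeasure \<mu> U = 1" if "\<mu> \<in> space weak_borel" for \<mu>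
  proof -
    have "space \<mu> = U" "prob_space \<mu>"
      using that sp True by (auto simp: prob_measures_def dest: sets_eq_imp_space_eq)
    then show ?thesis using prob_space.emeasure_space_1 by blast
  qed
  then show ?thesis by (subst measurable_cong) auto
next
  case False
  have sp: "space weak_borel = (prob_measures :: 'a measure set)"
    unfolding weak_borel_def by (rule space_measure_of_conv)
  define f where "f m x = min 1 (real m * infdist x (- U))" for m x
  have f_bound: "\<bar>f m x\<bar> \<le> 1" for m x
    using mult_nonneg_nonneg[OF of_nat_0_le_iff infdist_nonneg, of m x "- U"]
    by (auto simp: f_def abs_le_iff)
  have f: "continuous_on UNIV (f m)" "bounded (range (f m))" for m
  proof -
    show "continuous_on UNIV (f m)" unfolding f_def by (intro continuous_intros)
    show "bounded (range (f m))" using f_bound[of m] by (auto simp: bounded_iff)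
  qed
  have [measurable]: "f m \<in> borel_measurable borel" for m
    by (intro borel_measurable_continuous_onI f)
  have meas: "(\<lambda>\<mu>. \<integral>x. f m x \<partial>\<mu>) \<in> borel_measurable weak_borel" for m
  proof (rule borel_measurableI)
    fix S :: "real set" assume "open S"
    have "(\<lambda>\<mu>. \<integral>x. f m x \<partial>\<mu>) -` S \<inter> space weak_borel = {\<mu> \<in> prob_measures. (\<integral>x. f m x \<partial>\<mu>) \<in> S}"
      using sp by auto
    then show "(\<lambda>\<mu>. \<integral>x. f m x \<partial>\<mu>) -` S \<inter> space weak_borel \<in> sets weak_borel"
      using openin_weak_topology_integral[OF f \<open>open S\<close>, of m] by (auto simp: sets_weak_borel)
  qed
  have lim: "(\<lambda>m. f m x) \<longlonglongrightarrow> indicator U x" for x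
  proof (cases "x \<in> U")
    case True
    have "0 < infdist x (- U)"
    proof -
      have "infdist x (- U) \<noteq> 0"
        using in_closed_iff_infdist_zero[of "- U" x] assms False True by auto
      then show ?thesis using infdist_nonneg[of x "- U"] by linarith
    qed
    then obtain N :: nat where N: "1 / infdist x (- U) \<le> real N" using real_arch_simple by blast
    have "f m x = 1" if "N \<le> m" for m
    proof -
      have "1 / infdist x (- U) \<le> real m" using N that by (meson of_nat_mono order_trans)
      then have "1 \<le> real m * infdist x (- U)" using \<open>0 < infdist x (- U)\<close> by (simp add: divide_simps)
      then show ?thesis by (simp add: f_def)
    qed
    then show ?thesis using True by (intro tendsto_eventually) (auto simp: eventually_sequentially)
  next
    case False
    then show ?thesis by (auto simp: f_def)
  qed
  have "(\<lambda>\<mu>. measure \<mu> U) \<in> borel_measurable weak_borel"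
  proof (rule borel_measurable_LIMSEQ_real[OF _ meas])
    fix \<mu> :: "'a measure" assume "\<mu> \<in> space weak_borel"
    then have [measurable_cong]: "sets \<mu> = sets borel" and "prob_space \<mu>"
      using sp by (auto simp: prob_measures_def)
    interpret prob_space \<mu> by fact
    have "(\<lambda>m. \<integral>x. f m x \<partial>\<mu>) \<longlonglongrightarrow> (\<integral>x. indicator U x \<partial>\<mu>)"
      using borel_open[OF assms] by (intro integral_dominated_convergence[where w="\<lambda>_. 1"])
        (auto simp: lim f_bound)
    then show "(\<lambda>m. \<integral>x. f m x \<partial>\<mu>) \<longlonglongrightarrow> measure \<mu> U"
      using sets_eq_imp_space_eq[OF \<open>sets \<mu> = sets borel\<close>] by simp
  qed
  then have "(\<lambda>\<mu>. ennreal (measure \<mu> U)) \<in> borel_measurable weak_borel" by measurable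
  moreover have "emeasure \<mu> U = ennreal (measure \<mu> U)" if "\<mu> \<in> space weak_borel" for \<mu>
  proof -
    interpret prob_space \<mu> using that sp by (simp add: prob_measures_def)
    show ?thesis by (rule emeasure_eq_measure)
  qed
  ultimately show ?thesis by (subst measurable_cong) auto
qed

theorem sets_weak_borel_eq_prob_algebra:
  "sets (weak_borel :: 'a::polish_space measure measure) = sets (prob_algebra borel)"
proof (rule antisym)
  show "sets (weak_borel :: 'a measure measure) \<subseteq> sets (prob_algebra borel)"
    unfolding sets_weak_borel prob_measures_eq_space
    by (rule sets.sigma_sets_subset) (use weak_open_in_sets_prob_algebra in auto)
  have sp: "space weak_borel = (prob_measures :: 'a measure set)"
    unfolding weak_borel_def by (rule space_measure_of_conv)
  have "(\<lambda>\<mu>. \<mu>) \<in> weak_borel \<rightarrow>\<^sub>M prob_algebra (borel :: 'a measure)"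
  proof (rule measurable_prob_algebra_generated[where G="{U. open U}" and \<Omega>=UNIV])
    show "sets borel = sigma_sets UNIV {U :: 'a set. open U}" by (simp add: borel_def)
  qed (auto simp: Int_stable_def sp prob_measures_def intro: borel_measurable_emeasure_weak_borel)
  from measurable_sets[OF this] show "sets (prob_algebra borel) \<subseteq> sets (weak_borel :: 'a measure measure)"
    using sets.sets_into_space[of _ "prob_algebra (borel :: 'a measure)"]
    by (auto simp: sp prob_measures_eq_space Int_absorb2)
qed

section \<open>Product measures as kernels\<close>

text \<open>
  It suffices to test measurability on cylinders, where the product measure is a finite product.
\<close>

lemma measurable_PiM_kernel:
  fixes \<kappa> :: "nat \<Rightarrow> 'b \<Rightarrow> 'a::polish_space measure"
  assumes \<kappa>: "\<And>i. \<kappa> i \<in> N \<rightarrow>\<^sub>M prob_algebra borel"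
  shows "(\<lambda>x. \<Pi>\<^sub>M i\<in>UNIV. \<kappa> i x) \<in> N \<rightarrow>\<^sub>M prob_algebra seq_borel_inf"
proof (rule measurable_prob_algebra_generated[OF sets_PiM Int_stable_prod_algebra prod_algebra_sets_into_space])
  fix x assume x: "x \<in> space N"
  have p: "prob_space (\<kappa> i x)" and s: "sets (\<kappa> i x) = sets borel" for i
    using measurable_space[OF \<kappa> x, of i] by (auto simp: space_prob_algebra)
  show "prob_space (\<Pi>\<^sub>M i\<in>UNIV. \<kappa> i x)" using p by (intro prob_space_PiM)
  show "sets (\<Pi>\<^sub>M i\<in>UNIV. \<kappa> i x) = sets seq_borel_inf" using s by (intro sets_PiM_cong) auto
next
  fix A :: "(nat \<Rightarrow> 'a) set" assume "A \<in> prod_algebra UNIV (\<lambda>_. borel)"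
  then obtain J E where A: "A = prod_emb UNIV (\<lambda>_. borel) J (\<Pi>\<^sub>E j\<in>J. E j)"
    and J: "finite J" "\<And>j. j \<in> J \<Longrightarrow> E j \<in> sets borel"
    by (elim prod_algebraE) auto
  have eq: "emeasure (\<Pi>\<^sub>M i\<in>UNIV. \<kappa> i x) A = (\<Prod>j\<in>J. emeasure (\<kappa> j x) (E j))" if x: "x \<in> space N" for x
  proof -
    have p: "prob_space (\<kappa> i x)" and s: "sets (\<kappa> i x) = sets borel" for i
      using measurable_space[OF \<kappa> x, of i] by (auto simp: space_prob_algebra)
    have "A = prod_emb UNIV (\<lambda>i. \<kappa> i x) J (\<Pi>\<^sub>E j\<in>J. E j)"
      using s[THEN sets_eq_imp_space_eq] by (simp add: A prod_emb_def)
    then show ?thesis using J p s by (simp add: emeasure_PiM_emb)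
  qed
  have "(\<lambda>x. emeasure (\<kappa> j x) (E j)) \<in> borel_measurable N" if "j \<in> J" for j
    using measurable_compose[OF measurable_prob_algebraD[OF \<kappa>] measurable_emeasure_subprob_algebra] J(2)[OF that] .
  then have "(\<lambda>x. \<Prod>j\<in>J. emeasure (\<kappa> j x) (E j)) \<in> borel_measurable N"
    by (intro borel_measurable_prod_ennreal)
  then show "(\<lambda>x. emeasure (\<Pi>\<^sub>M i\<in>UNIV. \<kappa> i x) A) \<in> borel_measurable N"
    by (subst measurable_cong[OF eq])
qed

section \<open>Empirical frequencies of exchangeable sequences\<close>

locale exchangeable_seq = prob_space M for M :: "(nat \<Rightarrow> 'a::polish_space) measure" +
  assumes sets_M [measurable_cong]: "sets M = sets seq_borel_inf"
    and distr_permute: "\<And>n \<pi>. \<pi> permutes {..<n} \<Longrightarrow> distr M seq_borel_inf (\<lambda>\<omega> i. \<omega> (\<pi> i)) = M"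
begin

lemma space_M [simp]: "space M = UNIV"
  using sets_eq_imp_space_eq[OF sets_M] by (simp add: space_PiM)

lemma measurable_permute [measurable]: "(\<lambda>\<omega> i. \<omega> (\<pi> i)) \<in> M \<rightarrow>\<^sub>M seq_borel_inf"
  by (rule measurable_PiM_single') auto

lemma integral_permute:
  fixes f :: "_ \<Rightarrow> real"
  assumes "\<pi> permutes {..<n}" "f \<in> borel_measurable M"
  shows "(\<integral>\<omega>. f (\<lambda>i. \<omega> (\<pi> i)) \<partial>M) = (\<integral>\<omega>. f \<omega> \<partial>M)"
proof -
  have [measurable]: "f \<in> borel_measurable seq_borel_inf" using assms(2) by measurable
  show ?thesis by (subst (2) distr_permute[OF assms(1), symmetric]) (simp add: integral_distr)
qed

lemma AE_permute:
  assumes "\<pi> permutes {..<n}" "AE \<omega> in M. P \<omega>"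
  shows "AE \<omega> in M. P (\<lambda>i. \<omega> (\<pi> i))"
proof -
  have "AE \<omega> in distr M seq_borel_inf (\<lambda>\<omega> i. \<omega> (\<pi> i)). P \<omega>"
    by (subst distr_permute[OF assms(1)]) (rule assms(2))
  then show ?thesis by (rule AE_distrD[OF measurable_permute])
qed

end

text \<open>
  The relative frequency of \<open>B\<close> among the first \<open>4 ^ k\<close> coordinates.  Along this geometric sequence of
  sample sizes the \<open>L\<^sup>1\<close>-norms of the increments are summable, which gives almost sure convergence
  without a martingale or ergodic theorem.
\<close>

definition freq :: "nat \<Rightarrow> 'a set \<Rightarrow> (nat \<Rightarrow> 'a) \<Rightarrow> real" where
  "freq k B \<omega> = (\<Sum>j<4 ^ k. indicator B (\<omega> j)) / 4 ^ k"

lemma freq_nonneg: "0 \<le> freq k B \<omega>"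
  by (simp add: freq_def sum_nonneg)

lemma freq_le_1: "freq k B \<omega> \<le> 1"
proof -
  have "(\<Sum>j<4 ^ k. indicator B (\<omega> j)) \<le> (\<Sum>j<(4::nat) ^ k. 1 :: real)"
    by (intro sum_mono) (auto simp: indicator_def)
  then show ?thesis by (simp add: freq_def)
qed

context exchangeable_seq
begin

lemma measurable_freq [measurable]:
  assumes [measurable]: "B \<in> sets borel"
  shows "freq k B \<in> borel_measurable M"
  unfolding freq_def by measurable

lemma expectation_indicator:
  assumes [measurable]: "B \<in> sets borel"
  shows "expectation (\<lambda>\<omega>. indicator B (\<omega> i)) = measure (distr M borel (\<lambda>\<omega>. \<omega> 0)) B"
proof -
  have p: "Transposition.transpose 0 i permutes {..<Suc i}" by (rule permutes_swap_id) auto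
  have "expectation (\<lambda>\<omega>. indicator B (\<omega> i) :: real) = expectation (\<lambda>\<omega>. indicator B (\<omega> 0))"
    using integral_permute[OF p, of "\<lambda>\<omega>. indicator B (\<omega> 0)"] by simp
  also have "\<dots> = measure (distr M borel (\<lambda>\<omega>. \<omega> 0)) B"
  proof -
    have "expectation (\<lambda>\<omega>. indicator B (\<omega> 0) :: real) = expectation (indicator ((\<lambda>\<omega>. \<omega> 0) -` B \<inter> space M))"
      by (intro Bochner_Integration.integral_cong) (auto simp: indicator_def)
    then show ?thesis by (simp add: measure_distr)
  qed
  finally show ?thesis .
qed

lemma expectation_freq:
  assumes [measurable]: "B \<in> sets borel"
  shows "expectation (freq k B) = measure (distr M borel (\<lambda>\<omega>. \<omega> 0)) B"
proof -
  have "expectation (\<lambda>\<omega>. \<Sum>j<4 ^ k. indicator B (\<omega> j) :: real)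
      = (\<Sum>j<(4::nat) ^ k. expectation (\<lambda>\<omega>. indicator B (\<omega> j)))"
    by (intro Bochner_Integration.integral_sum integrable_const_bound[where B=1])
      (auto simp: indicator_def)
  then show ?thesis by (simp add: freq_def[abs_def] expectation_indicator)
qed

text \<open>
  The permutation \<open>\<pi>\<close> in the proof sends \<open>0\<close> to \<open>i\<close> and \<open>1\<close> to \<open>j\<close>.
\<close>

lemma expectation_indicator_pair:
  assumes [measurable]: "B \<in> sets borel" and "i \<noteq> j"
  shows "expectation (\<lambda>\<omega>. indicator B (\<omega> i) * indicator B (\<omega> j) :: real)
    = expectation (\<lambda>\<omega>. indicator B (\<omega> 0) * indicator B (\<omega> 1))"
proof -
  define j' where "j' = Transposition.transpose 0 i j"
  define \<pi> where "\<pi> = Transposition.transpose 0 i \<circ> Transposition.transpose 1 j'"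
  have "j' \<noteq> 0" using assms(2) by (auto simp: j'_def Transposition.transpose_def)
  have p: "\<pi> permutes {..<i + j + 2}"
    unfolding \<pi>_def by (intro permutes_compose permutes_swap_id) (auto simp: j'_def Transposition.transpose_def)
  have "\<pi> 0 = i" using \<open>j' \<noteq> 0\<close> by (simp add: \<pi>_def)
  moreover have "\<pi> 1 = j" by (simp add: \<pi>_def j'_def)
  ultimately show ?thesis
    using integral_permute[OF p, of "\<lambda>\<omega>. indicator B (\<omega> 0) * indicator B (\<omega> 1)"] by simp
qed

text \<open>
  All pairs of distinct coordinates have the same mixed moment \<open>b\<close>, so the off-diagonal
  contribution to the second moment is \<open>b * (\<Sum>j<N. c j)\<^sup>2\<close> plus a diagonal correction, and it vanishes for
  coefficients that sum to \<open>0\<close>.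
\<close>

lemma second_moment_contrast:
  fixes c :: "nat \<Rightarrow> real"
  assumes [measurable]: "B \<in> sets borel" and c: "(\<Sum>j<N. c j) = 0"
  shows "expectation (\<lambda>\<omega>. (\<Sum>j<N. c j * indicator B (\<omega> j))\<^sup>2) \<le> (\<Sum>j<N. (c j)\<^sup>2)"
proof -
  define a where "a = expectation (\<lambda>\<omega>. indicator B (\<omega> 0) :: real)"
  define b where "b = expectation (\<lambda>\<omega>. indicator B (\<omega> 0) * indicator B (\<omega> 1) :: real)"
  have E: "expectation (\<lambda>\<omega>. indicator B (\<omega> i) * indicator B (\<omega> j) :: real) = b + (if i = j then a - b else 0)" for i j
  proof (cases "i = j")
    case True
    have "(\<lambda>\<omega>. indicator B (\<omega> i) * indicator B (\<omega> i) :: real) = (\<lambda>\<omega>. indicator B (\<omega> i))"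
      by (auto simp: indicator_def)
    then show ?thesis using True by (simp add: a_def expectation_indicator)
  next
    case False then show ?thesis
      using expectation_indicator_pair[OF assms(1) False] by (simp add: b_def)
  qed
  have int: "integrable M (\<lambda>\<omega>. c i * (c j * (indicator B (\<omega> i) * indicator B (\<omega> j) :: real)))" for i j
    by (intro integrable_mult_right integrable_const_bound[where B=1]) (auto simp: indicator_def)
  have "a - b \<le> 1"
  proof -
    have "a \<le> 1" unfolding a_def expectation_indicator[OF assms(1)]
      by (intro prob_space.prob_le_1 prob_space_distr) measurable
    moreover have "0 \<le> b" unfolding b_def by (intro Bochner_Integration.integral_nonneg) auto
    ultimately show ?thesis by simp
  qed
  have "expectation (\<lambda>\<omega>. (\<Sum>j<N. c j * indicator B (\<omega> j))\<^sup>2)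
      = expectation (\<lambda>\<omega>. \<Sum>i<N. \<Sum>j<N. c i * (c j * (indicator B (\<omega> i) * indicator B (\<omega> j))))"
    unfolding power2_eq_square sum_product by (simp only: mult_ac)
  also have "\<dots> = (\<Sum>i<N. \<Sum>j<N. c i * (c j * (b + (if i = j then a - b else 0))))"
    using int by (simp add: E Bochner_Integration.integral_sum integrable_sum)
  also have "\<dots> = (\<Sum>i<N. c i * (b * (\<Sum>j<N. c j) + c i * (a - b)))"
  proof (intro sum.cong refl)
    fix i assume "i \<in> {..<N}"
    then have "(\<Sum>j<N. c j * (if i = j then a - b else 0)) = c i * (a - b)"
      by (simp add: if_distrib[of "\<lambda>t. c _ * t"] cong: if_cong)
    then show "(\<Sum>j<N. c i * (c j * (b + (if i = j then a - b else 0)))) = c i * (b * (\<Sum>j<N. c j) + c i * (a - b))"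
      by (simp add: sum_distrib_left[symmetric] distrib_left sum.distrib sum_distrib_right[symmetric])
  qed
  also have "\<dots> = (a - b) * (\<Sum>i<N. (c i)\<^sup>2)"
    by (simp add: c sum_distrib_left power2_eq_square mult_ac)
  also have "\<dots> \<le> 1 * (\<Sum>i<N. (c i)\<^sup>2)"
    using \<open>a - b \<le> 1\<close> by (intro mult_right_mono sum_nonneg) auto
  finally show ?thesis by simp
qed

text \<open>
  The increment is a contrast whose coefficients have square sum \<open>1 / 4 ^ k - 1 / 4 ^ Suc k\<close>.
\<close>

lemma freq_increment_L1:
  assumes [measurable]: "B \<in> sets borel"
  shows "expectation (\<lambda>\<omega>. \<bar>freq (Suc k) B \<omega> - freq k B \<omega>\<bar>) \<le> (1 / 2) ^ k"
proof -
  let ?N = "(4::nat) ^ k" and ?N' = "(4::nat) ^ Suc k"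
  \<comment> \<open>The coefficients of the increment as a linear combination of indicators; they sum to \<open>0\<close>.\<close>
  define c :: "nat \<Rightarrow> real" where "c j = 1 / ?N' - (if j < ?N then 1 / ?N else 0)" for j
  have sum_if: "(\<Sum>j<?N'. if j < ?N then t else (0::real)) = real ?N * t" for t
  proof -
    have "(\<Sum>j<?N'. if j < ?N then t else 0) = (\<Sum>j<?N. t)"
      by (rule sum.mono_neutral_cong_right) auto
    then show ?thesis by simp
  qed
  have c0: "(\<Sum>j<?N'. c j) = 0"
    unfolding c_def sum_subtractf sum_if by simp
  have c2: "(\<Sum>j<?N'. (c j)\<^sup>2) \<le> 1 / ?N"
  proof -
    have "(\<Sum>j<?N'. (c j)\<^sup>2) = (\<Sum>j<?N'. (1 / ?N')\<^sup>2 + (if j < ?N then (1 / ?N)\<^sup>2 - 2 * (1 / ?N') * (1 / ?N) else 0))"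
      by (intro sum.cong) (auto simp: c_def power2_diff)
    also have "\<dots> = 1 / ?N - 1 / ?N'"
      unfolding sum.distrib sum_if by (simp add: power2_eq_square field_simps)
    finally show ?thesis by (simp add: field_simps)
  qed
  let ?D = "\<lambda>\<omega>. freq (Suc k) B \<omega> - freq k B \<omega>"
  have D: "?D \<omega> = (\<Sum>j<?N'. c j * indicator B (\<omega> j))" for \<omega>
  proof -
    have "(\<Sum>j<?N'. c j * indicator B (\<omega> j)) = (\<Sum>j<?N'. indicator B (\<omega> j) / ?N') - (\<Sum>j<?N'. (if j < ?N then indicator B (\<omega> j) / ?N else 0))"
      unfolding sum_subtractf[symmetric] by (intro sum.cong) (auto simp: c_def left_diff_distrib)
    also have "(\<Sum>j<?N'. (if j < ?N then indicator B (\<omega> j) / ?N else 0)) = (\<Sum>j<?N. indicator B (\<omega> j) / (?N::real))"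
      by (rule sum.mono_neutral_cong_right) auto
    finally show ?thesis by (simp add: freq_def sum_divide_distrib)
  qed
  have D_le: "\<bar>?D \<omega>\<bar> \<le> 1" for \<omega>
    using freq_nonneg[of k B \<omega>] freq_nonneg[of "Suc k" B \<omega>] freq_le_1[of k B \<omega>] freq_le_1[of "Suc k" B \<omega>] by linarith
  have int1: "integrable M (\<lambda>\<omega>. \<bar>?D \<omega>\<bar>)"
    by (intro integrable_const_bound[where B=1]) (use D_le in auto)
  have int2: "integrable M (\<lambda>\<omega>. (?D \<omega>)\<^sup>2)"
    by (intro integrable_const_bound[where B=1]) (use D_le in \<open>auto simp: abs_square_le_1\<close>)
  have "expectation (\<lambda>\<omega>. (?D \<omega>)\<^sup>2) \<le> 1 / ?N"
    using second_moment_contrast[OF assms c0] c2 unfolding D by simp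
  \<comment> \<open>The inequality of arithmetic and geometric means replaces the Cauchy-Schwarz inequality.\<close>
  have amgm: "\<bar>?D \<omega>\<bar> \<le> (2 ^ k * (?D \<omega>)\<^sup>2 + (1 / 2) ^ k) / 2" for \<omega>
  proof -
    have "0 \<le> (2 ^ k * \<bar>?D \<omega>\<bar> - 1)\<^sup>2 * (1 / 2) ^ k" by simp
    also have "\<dots> = 2 ^ k * (?D \<omega>)\<^sup>2 - 2 * \<bar>?D \<omega>\<bar> + (1 / 2) ^ k"
      by (simp add: power2_eq_square algebra_simps power_divide)
    finally show ?thesis by simp
  qed
  have "expectation (\<lambda>\<omega>. \<bar>?D \<omega>\<bar>) \<le> expectation (\<lambda>\<omega>. (2 ^ k * (?D \<omega>)\<^sup>2 + (1 / 2) ^ k) / 2)"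
    using int1 int2 by (intro integral_mono amgm) auto
  also have "\<dots> = (2 ^ k * expectation (\<lambda>\<omega>. (?D \<omega>)\<^sup>2) + (1 / 2) ^ k) / 2"
    using int2 prob_space by simp
  also have "\<dots> \<le> (2 ^ k * (1 / ?N) + (1 / 2) ^ k) / 2"
    using \<open>expectation (\<lambda>\<omega>. (?D \<omega>)\<^sup>2) \<le> 1 / ?N\<close> by (intro divide_right_mono add_right_mono mult_left_mono) auto
  also have "\<dots> = (1 / 2) ^ k"
  proof -
    have "2 ^ k * (1 / real ?N) = (1 / 2) ^ k"
      by (simp add: power_mult_distrib[symmetric] power_divide[symmetric])
    then show ?thesis by simp
  qed
  finally show ?thesis .
qed

end

text \<open>
  The expectation of the sum is finite by monotone convergence, so the sum is almost surely finite.
\<close>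

lemma (in prob_space) AE_summable_of_expectation_le:
  fixes f :: "nat \<Rightarrow> 'a \<Rightarrow> real"
  assumes f: "\<And>n. integrable M (f n)" "\<And>n \<omega>. 0 \<le> f n \<omega>"
    and le: "\<And>n. expectation (f n) \<le> g n" and g: "summable g"
  shows "AE \<omega> in M. summable (\<lambda>n. f n \<omega>)"
proof -
  have [measurable]: "f n \<in> borel_measurable M" for n using f(1) by auto
  have g0: "0 \<le> g n" for n using le[of n] f(2) by (meson Bochner_Integration.integral_nonneg order_trans)
  have "(\<integral>\<^sup>+\<omega>. (\<Sum>n. ennreal (f n \<omega>)) \<partial>M) = (\<Sum>n. \<integral>\<^sup>+\<omega>. ennreal (f n \<omega>) \<partial>M)"
    by (rule nn_integral_suminf) measurable
  also have "\<dots> \<le> (\<Sum>n. ennreal (g n))"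
    using f le by (intro suminf_le) (auto simp: nn_integral_eq_integral ennreal_leI)
  also have "\<dots> < \<infinity>" using g g0 by (simp add: suminf_ennreal2)
  finally have "AE \<omega> in M. (\<Sum>n. ennreal (f n \<omega>)) \<noteq> \<infinity>"
    by (intro nn_integral_PInf_AE) auto
  then show ?thesis
    by (rule AE_mp) (auto intro!: AE_I2 summable_suminf_not_top simp: f(2))
qed

lemma (in exchangeable_seq) AE_convergent_freq:
  assumes [measurable]: "B \<in> sets borel"
  shows "AE \<omega> in M. convergent (\<lambda>k. freq k B \<omega>)"
proof -
  have "AE \<omega> in M. summable (\<lambda>k. \<bar>freq (Suc k) B \<omega> - freq k B \<omega>\<bar>)"
  proof (rule AE_summable_of_expectation_le[OF _ _ freq_increment_L1])
    have "\<bar>freq (Suc k) B \<omega> - freq k B \<omega>\<bar> \<le> 1" for k \<omega>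
      using freq_nonneg[of k B \<omega>] freq_nonneg[of "Suc k" B \<omega>] freq_le_1[of k B \<omega>] freq_le_1[of "Suc k" B \<omega>] by linarith
    then show "integrable M (\<lambda>\<omega>. \<bar>freq (Suc k) B \<omega> - freq k B \<omega>\<bar>)" for k
      by (intro integrable_const_bound[where B=1]) auto
  qed auto
  then show ?thesis
  proof (rule AE_mp, intro AE_I2 impI)
    fix \<omega> assume "summable (\<lambda>k. \<bar>freq (Suc k) B \<omega> - freq k B \<omega>\<bar>)"
    then have "summable (\<lambda>k. freq (Suc k) B \<omega> - freq k B \<omega>)" by (rule summable_rabs_cancel)
    then have "convergent (\<lambda>n. \<Sum>k<n. freq (Suc k) B \<omega> - freq k B \<omega>)" by (simp add: summable_iff_convergent)
    then have "convergent (\<lambda>n. freq n B \<omega> - freq 0 B \<omega>)" by (simp only: sum_lessThan_telescope[of "\<lambda>n. freq n B \<omega>"])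
    then have "convergent (\<lambda>n. (freq n B \<omega> - freq 0 B \<omega>) + freq 0 B \<omega>)"
      by (intro convergent_add convergent_const)
    then show "convergent (\<lambda>k. freq k B \<omega>)" by simp
  qed
qed

section \<open>The directing random measure\<close>

text \<open>
  Syntax for finite Boolean combinations of the members of a sequence of sets.  Its only purpose is
  that the algebra generated by the sequence is the range of a function on a countable type, hence countable.
\<close>

datatype set_expr = Gen nat | Complement set_expr | Join set_expr set_expr

instance set_expr :: countable
  by countable_datatype

primrec denote :: "(nat \<Rightarrow> 'a set) \<Rightarrow> set_expr \<Rightarrow> 'a set" where
  "denote U (Gen i) = U i"
| "denote U (Complement e) = - denote U e"
| "denote U (Join e f) = denote U e \<union> denote U f"

lemma countable_algebra_generating_borel:
  "\<exists>\<A> :: 'a::second_countable_topology set set.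
     countable \<A> \<and> algebra UNIV \<A> \<and> sigma_sets UNIV \<A> = sets borel"
proof -
  obtain \<B> :: "'a set set" where \<B>: "countable \<B>" "topological_basis \<B>"
    using ex_countable_basis by auto
  from \<B>(2) open_UNIV have "\<exists>\<B>'\<subseteq>\<B>. \<Union>\<B>' = UNIV" by (auto simp: topological_basis_def)
  then have "\<B> \<noteq> {}" by auto
  define U where "U = from_nat_into \<B>"
  have U: "range U = \<B>" unfolding U_def by (rule range_from_nat_into) fact+
  have borel_eq: "(borel :: 'a measure) = sigma UNIV \<B>" by (rule borel_eq_countable_basis) fact+
  have "denote U e \<in> sets borel" for e
  proof (induction e)
    case (Gen i)
    have "U i \<in> \<B>" using U rangeI[of U i] by simp
    then show ?case using topological_basis_open[OF \<B>(2)] by simp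
  qed (simp_all add: borel_comp sets.Un)
  then have sub: "range (denote U) \<subseteq> sets borel" by auto
  have "algebra UNIV (range (denote U))"
    unfolding algebra_iff_Un
  proof (intro conjI ballI)
    have "denote U (Complement (Join (Gen 0) (Complement (Gen 0)))) = {}" by auto
    then show "{} \<in> range (denote U)" by (rule range_eqI[OF sym])
    fix a assume "a \<in> range (denote U)"
    then obtain e where e: "a = denote U e" by auto
    show "UNIV - a \<in> range (denote U)"
      by (rule range_eqI[of _ _ "Complement e"]) (auto simp: e)
    fix b assume "b \<in> range (denote U)"
    then obtain f where f: "b = denote U f" by auto
    show "a \<union> b \<in> range (denote U)"
      by (rule range_eqI[of _ _ "Join e f"]) (auto simp: e f)
  qed auto
  moreover have "sigma_sets UNIV (range (denote U)) = sets borel"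
  proof (rule antisym)
    show "sigma_sets UNIV (range (denote U)) \<subseteq> sets borel"
      using sets.sigma_sets_subset[OF sub] by simp
    have "U i \<in> range (denote U)" for i by (rule range_eqI[of _ _ "Gen i"]) simp
    then have "\<B> \<subseteq> range (denote U)" using U by auto
    then show "sets borel \<subseteq> sigma_sets UNIV (range (denote U))"
      unfolding borel_eq by (simp add: sigma_sets_mono')
  qed
  ultimately show ?thesis by (intro exI[of _ "range (denote U)"]) auto
qed

definition limit_freq :: "'a set \<Rightarrow> (nat \<Rightarrow> 'a) \<Rightarrow> real" where
  "limit_freq B \<omega> = lim (\<lambda>k. freq k B \<omega>)"

lemma freq_tendsto_limit_freq:
  "convergent (\<lambda>k. freq k B \<omega>) \<Longrightarrow> (\<lambda>k. freq k B \<omega>) \<longlonglongrightarrow> limit_freq B \<omega>"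
  by (simp add: limit_freq_def convergent_LIMSEQ_iff)

lemma limit_freq_nonneg: "convergent (\<lambda>k. freq k B \<omega>) \<Longrightarrow> 0 \<le> limit_freq B \<omega>"
  by (rule LIMSEQ_le_const[OF freq_tendsto_limit_freq]) (auto simp: freq_nonneg)

lemma freq_Un_disjoint: "A \<inter> B = {} \<Longrightarrow> freq k (A \<union> B) \<omega> = freq k A \<omega> + freq k B \<omega>"
  by (simp add: freq_def indicator_add[symmetric] sum.distrib add_divide_distrib)

lemma freq_le_sum:
  assumes "B \<subseteq> (\<Union>n\<in>I. C n)" "finite I"
  shows "freq k B \<omega> \<le> (\<Sum>n\<in>I. freq k (C n) \<omega>)"
proof -
  have *: "indicator B x \<le> (\<Sum>n\<in>I. indicator (C n) x :: real)" for x
  proof (cases "x \<in> B")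
    case True
    then obtain n where n: "n \<in> I" "x \<in> C n" using assms(1) by auto
    have "indicator (C n) x \<le> (\<Sum>n\<in>I. indicator (C n) x :: real)"
      by (rule member_le_sum) (use n assms(2) in auto)
    with n True show ?thesis by simp
  qed (simp add: sum_nonneg)
  have "(\<Sum>j<4 ^ k. indicator B (\<omega> j)) \<le> (\<Sum>j<4 ^ k. \<Sum>n\<in>I. indicator (C n) (\<omega> j) :: real)"
    by (intro sum_mono *)
  also have "\<dots> = (\<Sum>n\<in>I. \<Sum>j<4 ^ k. indicator (C n) (\<omega> j))" by (rule sum.swap)
  finally show ?thesis
    by (simp add: freq_def sum_divide_distrib[symmetric] divide_right_mono)
qed

text \<open>
  Only finite additivity is inherited from the frequencies.  Continuity at the empty set comes from
  compact approximation: if \<open>A n\<close> decreases to the empty set and \<open>C n \<subseteq> A n\<close> is compact with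
  \<open>A n - C n\<close> of limiting frequency below \<open>e / 2 ^ Suc n\<close>, then finitely many \<open>C n\<close> already have empty
  intersection, so that \<open>A n\<close> is eventually covered by finitely many of the small differences.
\<close>

lemma limit_freq_extends_to_measure:
  fixes \<omega> :: "nat \<Rightarrow> 'a::metric_space"
  assumes \<A>: "algebra UNIV \<A>" "sigma_sets UNIV \<A> = sets borel"
    and conv: "\<And>B. B \<in> \<A> \<Longrightarrow> convergent (\<lambda>k. freq k B \<omega>)"
    and K: "\<And>B n. B \<in> \<A> \<Longrightarrow> compact (K B n) \<and> K B n \<subseteq> B"
    and conv': "\<And>B n. B \<in> \<A> \<Longrightarrow> convergent (\<lambda>k. freq k (B - K B n) \<omega>)"
    and tight: "\<And>B. B \<in> \<A> \<Longrightarrow> (\<lambda>n. limit_freq (B - K B n) \<omega>) \<longlonglongrightarrow> 0"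
  shows "\<exists>\<mu>. sets \<mu> = sets borel \<and> prob_space \<mu> \<and> (\<forall>B\<in>\<A>. emeasure \<mu> B = ennreal (limit_freq B \<omega>))"
proof -
  interpret algebra UNIV \<A> by fact
  note lim = freq_tendsto_limit_freq[OF conv]
  have empty: "limit_freq {} \<omega> = 0" and univ: "limit_freq UNIV \<omega> = 1"
    by (auto simp: limit_freq_def freq_def)
  have add: "limit_freq (A \<union> B) \<omega> = limit_freq A \<omega> + limit_freq B \<omega>"
    if "A \<in> \<A>" "B \<in> \<A>" "A \<inter> B = {}" for A B
  proof (rule LIMSEQ_unique[OF lim])
    show "(\<lambda>k. freq k (A \<union> B) \<omega>) \<longlonglongrightarrow> limit_freq A \<omega> + limit_freq B \<omega>"
      unfolding freq_Un_disjoint[OF that(3)] by (intro tendsto_add lim that)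
  qed (use that in auto)
  have "\<exists>\<mu> :: 'a set \<Rightarrow> ennreal. (\<forall>s\<in>\<A>. \<mu> s = ennreal (limit_freq s \<omega>)) \<and> measure_space UNIV (sigma_sets UNIV \<A>) \<mu>"
  proof (rule caratheodory_empty_continuous)
    show "positive \<A> (\<lambda>B. ennreal (limit_freq B \<omega>))" by (simp add: positive_def empty)
    show "additive \<A> (\<lambda>B. ennreal (limit_freq B \<omega>))"
      by (auto simp: additive_def add ennreal_plus limit_freq_nonneg conv)
  next
    fix A :: "nat \<Rightarrow> 'a set" assume A: "range A \<subseteq> \<A>" "decseq A" "(\<Inter>i. A i) = {}"
    then have A': "A n \<in> \<A>" for n by auto
    have "(\<lambda>i. limit_freq (A i) \<omega>) \<longlonglongrightarrow> 0"
    proof (rule LIMSEQ_I)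
      fix e :: real assume e: "0 < e"
      have "\<exists>m. limit_freq (A n - K (A n) m) \<omega> < e * (1 / 2) ^ Suc n" for n
      proof -
        have "\<forall>\<^sub>F m in sequentially. limit_freq (A n - K (A n) m) \<omega> < e * (1 / 2) ^ Suc n"
          by (rule order_tendstoD(2)[OF tight[OF A']]) (use e in simp)
        then show ?thesis by (auto simp: eventually_sequentially)
      qed
      then obtain m where m: "\<And>n. limit_freq (A n - K (A n) (m n)) \<omega> < e * (1 / 2) ^ Suc n"
        by metis
      define C where "C n = K (A n) (m n)" for n
      have C: "compact (C n)" "C n \<subseteq> A n" for n using K[OF A'] by (auto simp: C_def)
      \<comment> \<open>Compactness: an empty intersection of the \<open>C n\<close> is already empty at a finite stage.\<close>
      have "\<exists>N. (\<Inter>i\<in>{..N}. C i) = {}"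
      proof (rule ccontr)
        assume ne: "\<nexists>N. (\<Inter>i\<in>{..N}. C i) = {}"
        have "C 0 \<inter> (\<Inter>i\<in>UNIV. C i) \<noteq> {}"
        proof (rule compact_imp_fip_image)
          fix I' :: "nat set" assume "finite I'"
          then obtain N where "I' \<subseteq> {..N}" using finite_nat_iff_bounded_le by auto
          then have "(\<Inter>i\<in>{..N}. C i) \<subseteq> C 0 \<inter> (\<Inter>i\<in>I'. C i)" by auto
          with ne show "C 0 \<inter> (\<Inter>i\<in>I'. C i) \<noteq> {}" by (metis subset_empty)
        qed (auto intro: C compact_imp_closed)
        then have "(\<Inter>i. A i) \<noteq> {}" using C(2) by blast
        with A(3) show False by simp
      qed
      then obtain N where N: "(\<Inter>i\<in>{..N}. C i) = {}" by auto
      have small: "limit_freq (A n) \<omega> < e" if "N \<le> n" for n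
      proof -
        have "A n \<subseteq> (\<Union>i\<in>{..N}. A i - C i)"
        proof
          fix x assume x: "x \<in> A n"
          obtain i where "i \<le> N" "x \<notin> C i" using N by auto
          moreover have "x \<in> A i" using decseqD[OF A(2), of i n] x that \<open>i \<le> N\<close> by auto
          ultimately show "x \<in> (\<Union>i\<in>{..N}. A i - C i)" by auto
        qed
        then have "freq k (A n) \<omega> \<le> (\<Sum>i\<in>{..N}. freq k (A i - C i) \<omega>)" for k
          by (rule freq_le_sum) simp
        moreover have "(\<lambda>k. \<Sum>i\<in>{..N}. freq k (A i - C i) \<omega>) \<longlonglongrightarrow> (\<Sum>i\<in>{..N}. limit_freq (A i - C i) \<omega>)"
          unfolding C_def by (intro tendsto_sum freq_tendsto_limit_freq conv' A')
        ultimately have "limit_freq (A n) \<omega> \<le> (\<Sum>i\<in>{..N}. limit_freq (A i - C i) \<omega>)"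
          by (intro LIMSEQ_le[OF lim[OF A']]) auto
        also have "\<dots> < (\<Sum>i\<in>{..N}. e * (1 / 2) ^ Suc i)"
          unfolding C_def by (intro sum_strict_mono m) auto
        also have "\<dots> = e * (\<Sum>i<Suc N. (1 / 2) ^ Suc i)"
          by (simp only: sum_distrib_left lessThan_Suc_atMost)
        also have "(\<Sum>i<Suc N. (1 / 2 :: real) ^ Suc i) = 1 - (1 / 2) ^ Suc N"
        proof -
          have "(\<Sum>i<M. (1 / 2 :: real) ^ Suc i) = 1 - (1 / 2) ^ M" for M
            by (induction M) auto
          then show ?thesis by blast
        qed
        also have "e * (1 - (1 / 2) ^ Suc N) \<le> e * 1" using e by (intro mult_left_mono) auto
        finally show ?thesis by simp
      qed
      then show "\<exists>N. \<forall>n\<ge>N. norm (limit_freq (A n) \<omega> - 0) < e"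
        using limit_freq_nonneg[OF conv[OF A']] by auto
    qed
    from tendsto_ennrealI[OF this] show "(\<lambda>i. ennreal (limit_freq (A i) \<omega>)) \<longlonglongrightarrow> 0" by simp
  qed auto
  then obtain \<mu> where \<mu>: "\<And>s. s \<in> \<A> \<Longrightarrow> \<mu> s = ennreal (limit_freq s \<omega>)"
    and ms: "measure_space UNIV (sigma_sets UNIV \<A>) \<mu>" by auto
  let ?M = "measure_of UNIV \<A> \<mu>"
  have sets: "sets ?M = sets borel" using \<A>(2) by (simp add: space_closed)
  have em: "emeasure ?M B = ennreal (limit_freq B \<omega>)" if "B \<in> \<A>" for B
  proof -
    have "emeasure ?M B = \<mu> B"
      using ms that by (intro emeasure_measure_of) (auto simp: measure_space_def space_closed)
    then show ?thesis using \<mu>[OF that] by simp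
  qed
  have "prob_space ?M"
    using em[of UNIV] by (intro prob_spaceI) (simp add: univ space_measure_of_conv)
  with sets em show ?thesis by (intro exI[of _ ?M]) auto
qed

context exchangeable_seq
begin

lemma measurable_limit_freq [measurable]:
  assumes [measurable]: "B \<in> sets borel"
  shows "limit_freq B \<in> borel_measurable M"
  unfolding limit_freq_def[abs_def] by (rule borel_measurable_lim_metric) measurable

text \<open>
  The absolute value matters only on the null set where the frequencies diverge and \<open>limit_freq\<close> is
  an unspecified real number.
\<close>

lemma limit_freq_expectation:
  assumes [measurable]: "B \<in> sets borel"
  shows "integrable M (\<lambda>\<omega>. \<bar>limit_freq B \<omega>\<bar>)"
    "expectation (\<lambda>\<omega>. \<bar>limit_freq B \<omega>\<bar>) = measure (distr M borel (\<lambda>\<omega>. \<omega> 0)) B"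
proof -
  have lim: "AE \<omega> in M. (\<lambda>k. freq k B \<omega>) \<longlonglongrightarrow> \<bar>limit_freq B \<omega>\<bar>"
    using AE_convergent_freq[OF assms]
    by (rule AE_mp) (auto intro!: AE_I2 simp: limit_freq_nonneg freq_tendsto_limit_freq)
  have bound: "AE \<omega> in M. norm (freq k B \<omega>) \<le> 1" for k
    by (auto simp: freq_nonneg freq_le_1)
  show "integrable M (\<lambda>\<omega>. \<bar>limit_freq B \<omega>\<bar>)"
    by (rule integrable_dominated_convergence[OF _ _ _ lim bound]) auto
  have "(\<lambda>k. expectation (freq k B)) \<longlonglongrightarrow> expectation (\<lambda>\<omega>. \<bar>limit_freq B \<omega>\<bar>)"
    by (rule integral_dominated_convergence[OF _ _ _ lim bound]) auto
  then show "expectation (\<lambda>\<omega>. \<bar>limit_freq B \<omega>\<bar>) = measure (distr M borel (\<lambda>\<omega>. \<omega> 0)) B"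
    by (simp add: expectation_freq[OF assms] LIMSEQ_const_iff)
qed

text \<open>
  The compact sets come from inner regularity of the distribution \<open>\<nu>\<close> of one coordinate.  They are chosen
  with \<open>\<nu> (B - K B n) \<le> 1 / 2 ^ n\<close>; as \<open>\<nu>\<close> is the expectation of the limiting frequency, the limiting
  frequencies of \<open>B - K B n\<close> are almost surely summable in \<open>n\<close> and therefore tend to \<open>0\<close>.
\<close>

lemma directing_measure_exists:
  fixes \<A> :: "'a set set"
  assumes \<A>: "countable \<A>" "algebra UNIV \<A>" "sigma_sets UNIV \<A> = sets borel"
  shows "\<exists>\<kappa>. \<kappa> \<in> M \<rightarrow>\<^sub>M prob_algebra borel \<and>
    (AE \<omega> in M. \<forall>B\<in>\<A>. convergent (\<lambda>k. freq k B \<omega>) \<and> emeasure (\<kappa> \<omega>) B = ennreal (limit_freq B \<omega>))"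
proof -
  have borel: "B \<in> sets borel" if "B \<in> \<A>" for B using \<A>(3) that by (metis sigma_sets.Basic)
  let ?\<nu> = "distr M borel (\<lambda>\<omega>. \<omega> 0)"
  interpret \<nu>: prob_space ?\<nu> by (rule prob_space_distr) measurable
  have "\<exists>C. compact C \<and> C \<subseteq> B \<and> measure ?\<nu> (B - C) \<le> (1 / 2) ^ n" if B: "B \<in> \<A>" for B n
  proof -
    have reg: "emeasure ?\<nu> B = (SUP C\<in>{C. C \<subseteq> B \<and> compact C}. emeasure ?\<nu> C)"
      using \<nu>.emeasure_finite by (intro inner_regular) (auto simp: borel[OF B])
    have "\<exists>C\<in>{C. C \<subseteq> B \<and> compact C}. emeasure ?\<nu> B < emeasure ?\<nu> C + ennreal ((1 / 2) ^ n)"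
      unfolding reg by (rule SUP_approx_ennreal) (use \<nu>.emeasure_finite[of B] in \<open>auto simp: reg[symmetric]\<close>)
    then obtain C where C: "C \<subseteq> B" "compact C" "emeasure ?\<nu> B < emeasure ?\<nu> C + ennreal ((1 / 2) ^ n)" by auto
    have Cb: "C \<in> sets borel" using C(2) by (simp add: borel_closed compact_imp_closed)
    have "measure ?\<nu> B \<le> measure ?\<nu> C + (1 / 2) ^ n"
      using C(3) by (simp add: \<nu>.emeasure_eq_measure ennreal_plus[symmetric] ennreal_less_iff del: ennreal_plus)
    then show ?thesis
      using C(1,2) \<nu>.finite_measure_Diff[of B C] Cb borel[OF B] by (intro exI[of _ C]) auto
  qed
  then have "\<forall>B n. \<exists>C. B \<in> \<A> \<longrightarrow> compact C \<and> C \<subseteq> B \<and> measure ?\<nu> (B - C) \<le> (1 / 2) ^ n" by blast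
  then obtain K where K: "\<And>B n. B \<in> \<A> \<Longrightarrow> compact (K B n) \<and> K B n \<subseteq> B \<and> measure ?\<nu> (B - K B n) \<le> (1 / 2) ^ n"
    by metis
  have Kb: "B - K B n \<in> sets borel" if "B \<in> \<A>" for B n
    using K[OF that, of n] borel[OF that] by (simp add: sets.Diff borel_closed compact_imp_closed)
  define good where "good \<omega> \<longleftrightarrow> (\<forall>B\<in>\<A>. convergent (\<lambda>k. freq k B \<omega>) \<and>
    (\<forall>n. convergent (\<lambda>k. freq k (B - K B n) \<omega>)) \<and> (\<lambda>n. limit_freq (B - K B n) \<omega>) \<longlonglongrightarrow> 0)" for \<omega>
  have "AE \<omega> in M. good \<omega>"
    unfolding good_def AE_ball_countable[OF \<A>(1)]
  proof (intro ballI AE_conjI)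
    fix B assume B: "B \<in> \<A>"
    show "AE \<omega> in M. convergent (\<lambda>k. freq k B \<omega>)" by (rule AE_convergent_freq[OF borel[OF B]])
    show "AE \<omega> in M. \<forall>n. convergent (\<lambda>k. freq k (B - K B n) \<omega>)"
      unfolding AE_all_countable by (intro allI AE_convergent_freq Kb B)
    have "AE \<omega> in M. summable (\<lambda>n. \<bar>limit_freq (B - K B n) \<omega>\<bar>)"
      by (rule AE_summable_of_expectation_le[where g="\<lambda>n. (1 / 2) ^ n"])
        (auto simp: limit_freq_expectation[OF Kb[OF B]] K[OF B])
    then show "AE \<omega> in M. (\<lambda>n. limit_freq (B - K B n) \<omega>) \<longlonglongrightarrow> 0"
      by (rule AE_mp) (auto intro!: AE_I2 dest!: summable_LIMSEQ_zero simp: tendsto_rabs_zero_iff)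
  qed
  then obtain N where N: "{\<omega> \<in> space M. \<not> good \<omega>} \<subseteq> N" "emeasure M N = 0" "N \<in> sets M" by (rule AE_E)
  then have good: "good \<omega>" if "\<omega> \<notin> N" for \<omega> using that by auto
  have "\<exists>\<mu>. sets \<mu> = sets borel \<and> prob_space \<mu> \<and> (\<forall>B\<in>\<A>. emeasure \<mu> B = ennreal (limit_freq B \<omega>))"
    if "\<omega> \<notin> N" for \<omega>
    using good[OF that] K by (intro limit_freq_extends_to_measure[OF \<A>(2,3), where K=K]) (auto simp: good_def)
  then obtain \<mu> where \<mu>: "\<And>\<omega>. \<omega> \<notin> N \<Longrightarrow> sets (\<mu> \<omega>) = sets borel \<and> prob_space (\<mu> \<omega>) \<and>
      (\<forall>B\<in>\<A>. emeasure (\<mu> \<omega>) B = ennreal (limit_freq B \<omega>))"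
    by metis
  \<comment> \<open>On the exceptional null set any probability measure will do; a point mass keeps the kernel measurable.\<close>
  define \<kappa> where "\<kappa> \<omega> = (if \<omega> \<in> N then return borel undefined else \<mu> \<omega>)" for \<omega>
  have "\<kappa> \<in> M \<rightarrow>\<^sub>M prob_algebra borel"
  proof (rule measurable_prob_algebra_generated[OF \<A>(3)[symmetric]])
    show "Int_stable \<A>" using algebra.Int_stable[OF \<A>(2)] .
    show "prob_space (\<kappa> \<omega>)" "sets (\<kappa> \<omega>) = sets borel" for \<omega>
      using \<mu> by (auto simp: \<kappa>_def prob_space_return)
    fix B assume B: "B \<in> \<A>"
    note [measurable] = borel[OF B] N(3)
    have "(\<lambda>\<omega>. emeasure (\<kappa> \<omega>) B) = (\<lambda>\<omega>. if \<omega> \<in> N then indicator B undefined else ennreal (limit_freq B \<omega>))"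
      using \<mu> B by (auto simp: \<kappa>_def fun_eq_iff)
    also have "\<dots> \<in> borel_measurable M" by measurable
    finally show "(\<lambda>\<omega>. emeasure (\<kappa> \<omega>) B) \<in> borel_measurable M" .
  qed auto
  moreover have "AE \<omega> in M. \<forall>B\<in>\<A>. convergent (\<lambda>k. freq k B \<omega>) \<and> emeasure (\<kappa> \<omega>) B = ennreal (limit_freq B \<omega>)"
  proof (rule AE_I')
    show "N \<in> null_sets M" using N by auto
    show "{\<omega> \<in> space M. \<not> (\<forall>B\<in>\<A>. convergent (\<lambda>k. freq k B \<omega>) \<and> emeasure (\<kappa> \<omega>) B = ennreal (limit_freq B \<omega>))} \<subseteq> N"
      using good \<mu> by (auto simp: \<kappa>_def good_def)
  qed
  ultimately show ?thesis by auto
qed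

end

section \<open>De Finetti's theorem\<close>

text \<open>
  A permutation of the first \<open>n\<close> coordinates does not affect a frequency taken over at least \<open>n\<close>
  coordinates.  The equation holds also where the limit does not exist.
\<close>

lemma limit_freq_permute:
  assumes "\<pi> permutes {..<n}"
  shows "limit_freq B (\<lambda>i. \<omega> (\<pi> i)) = limit_freq B \<omega>"
proof -
  have eq: "freq k B (\<lambda>i. \<omega> (\<pi> i)) = freq k B \<omega>" if "n \<le> k" for k
  proof -
    have "n \<le> 4 ^ k" using that power_gt_expt[of 4 k] by simp
    then have "\<pi> permutes {..<4 ^ k}" using assms by (rule_tac permutes_subset) auto
    from sum.permute[OF this, of "\<lambda>j. indicator B (\<omega> j) :: real"] show ?thesis by (simp add: freq_def)
  qed
  have "(\<lambda>k. freq k B (\<lambda>i. \<omega> (\<pi> i))) \<longlonglongrightarrow> l \<longleftrightarrow> (\<lambda>k. freq k B \<omega>) \<longlonglongrightarrow> l" for l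
    by (rule tendsto_cong) (use eq in \<open>auto simp: eventually_sequentially\<close>)
  then show ?thesis by (simp add: limit_freq_def lim_def)
qed

context exchangeable_seq
begin

text \<open>
  As \<open>z\<close> does not change when the coordinates \<open>m\<close> and \<open>j \<ge> n\<close> are exchanged, the expectation of
  \<open>z \<omega> * indicator B (\<omega> j)\<close> is the same for \<open>j = m\<close> and for all \<open>j \<ge> n\<close>.  Averaging over the first
  \<open>4 ^ k\<close> values of \<open>j\<close> replaces the indicator by \<open>freq k B\<close>, up to an error from the \<open>n\<close> exceptional
  values that vanishes in the limit.
\<close>

lemma expectation_indicator_eq_limit_freq:
  fixes z :: "(nat \<Rightarrow> 'a) \<Rightarrow> real"
  assumes [measurable]: "z \<in> borel_measurable M" "B \<in> sets borel"
    and z: "\<And>\<omega>. \<bar>z \<omega>\<bar> \<le> 1"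
    and inv: "\<And>j. n \<le> j \<Longrightarrow> AE \<omega> in M. z (\<lambda>i. \<omega> (Transposition.transpose m j i)) = z \<omega>"
  shows "expectation (\<lambda>\<omega>. z \<omega> * indicator B (\<omega> m)) = expectation (\<lambda>\<omega>. z \<omega> * limit_freq B \<omega>)"
proof (rule LIMSEQ_unique)
  define h where "h j = expectation (\<lambda>\<omega>. z \<omega> * indicator B (\<omega> j))" for j
  have h_far: "h j = h m" if "n \<le> j" for j
  proof -
    let ?\<tau> = "Transposition.transpose m j"
    have \<tau>: "?\<tau> permutes {..<m + j + 1}" by (rule permutes_swap_id) auto
    have [measurable]: "z \<in> borel_measurable seq_borel_inf" using assms(1) by measurable
    have [measurable]: "(\<lambda>\<omega>. z (\<lambda>i. \<omega> (?\<tau> i))) \<in> borel_measurable M"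
      by (rule measurable_compose[OF measurable_permute]) fact
    have "h j = expectation (\<lambda>\<omega>. z (\<lambda>i. \<omega> (?\<tau> i)) * indicator B (\<omega> (?\<tau> j)))"
      unfolding h_def by (subst integral_permute[OF \<tau>, symmetric]) auto
    also have "\<dots> = h m"
      unfolding h_def using inv[OF that] by (intro integral_cong_AE) auto
    finally show ?thesis .
  qed
  have int: "integrable M (\<lambda>\<omega>. z \<omega> * indicator B (\<omega> j))" for j
    by (rule integrable_const_bound[where B=1]) (use z in \<open>auto simp: indicator_def\<close>)
  have "expectation (\<lambda>\<omega>. z \<omega> * freq k B \<omega>) = h m + (\<Sum>j<n. h j - h m) / 4 ^ k" if "n \<le> k" for k
  proof -
    have n: "n \<le> 4 ^ k" using that power_gt_expt[of 4 k] by simp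
    have "expectation (\<lambda>\<omega>. z \<omega> * freq k B \<omega>) = expectation (\<lambda>\<omega>. (\<Sum>j<4 ^ k. z \<omega> * indicator B (\<omega> j)) / 4 ^ k)"
      unfolding freq_def sum_distrib_left[symmetric] by simp
    also have "\<dots> = (\<Sum>j<4 ^ k. h j) / 4 ^ k"
      unfolding h_def integral_divide_zero by (subst Bochner_Integration.integral_sum[OF int]) simp
    also have "(\<Sum>j<4 ^ k. h j) = (\<Sum>j<(4::nat) ^ k. h m) + (\<Sum>j<(4::nat) ^ k. h j - h m)"
      by (simp add: sum_subtractf)
    also have "(\<Sum>j<(4::nat) ^ k. h j - h m) = (\<Sum>j<n. h j - h m)"
      using n h_far by (intro sum.mono_neutral_right) auto
    finally show ?thesis by (simp add: add_divide_distrib)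
  qed
  moreover have "(\<lambda>k. h m + (\<Sum>j<n. h j - h m) / 4 ^ k) \<longlonglongrightarrow> h m + 0"
    by (intro tendsto_add tendsto_const LIMSEQ_divide_realpow_zero) auto
  ultimately show "(\<lambda>k. expectation (\<lambda>\<omega>. z \<omega> * freq k B \<omega>)) \<longlonglongrightarrow> expectation (\<lambda>\<omega>. z \<omega> * indicator B (\<omega> m))"
    unfolding h_def[of m, symmetric]
    by (subst tendsto_cong[where g="\<lambda>k. h m + (\<Sum>j<n. h j - h m) / 4 ^ k"]) (auto simp: eventually_sequentially)
  show "(\<lambda>k. expectation (\<lambda>\<omega>. z \<omega> * freq k B \<omega>)) \<longlonglongrightarrow> expectation (\<lambda>\<omega>. z \<omega> * limit_freq B \<omega>)"
  proof (rule integral_dominated_convergence[where w="\<lambda>_. 1"])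
    show "AE \<omega> in M. (\<lambda>k. z \<omega> * freq k B \<omega>) \<longlonglongrightarrow> z \<omega> * limit_freq B \<omega>"
      using AE_convergent_freq[OF assms(2)]
      by (rule AE_mp) (auto intro!: AE_I2 tendsto_mult freq_tendsto_limit_freq)
    have "norm (z \<omega> * freq k B \<omega>) \<le> 1 * 1" for k \<omega>
      unfolding norm_mult by (rule mult_mono) (use z in \<open>auto simp: freq_nonneg freq_le_1\<close>)
    then show "AE \<omega> in M. norm (z \<omega> * freq k B \<omega>) \<le> 1" for k by simp
  qed auto
qed

end

text \<open>
  An exchangeable sequence with a fixed version \<open>\<kappa>\<close> of its directing random measure.
\<close>

locale directed_exchangeable_seq = exchangeable_seq M for M :: "(nat \<Rightarrow> 'a::polish_space) measure" +
  fixes \<A> :: "'a set set" and \<kappa> :: "(nat \<Rightarrow> 'a) \<Rightarrow> 'a measure"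
  assumes \<A>: "countable \<A>" "algebra UNIV \<A>" "sigma_sets UNIV \<A> = sets borel"
    and \<kappa> [measurable]: "\<kappa> \<in> M \<rightarrow>\<^sub>M prob_algebra borel"
    and AE_\<kappa>: "AE \<omega> in M. \<forall>B\<in>\<A>. convergent (\<lambda>k. freq k B \<omega>) \<and> emeasure (\<kappa> \<omega>) B = ennreal (limit_freq B \<omega>)"
begin

lemma sets_\<kappa>: "sets (\<kappa> \<omega>) = sets borel" and prob_\<kappa>: "prob_space (\<kappa> \<omega>)"
  using measurable_space[OF \<kappa>, of \<omega>] by (auto simp: space_prob_algebra)

lemma measurable_emeasure_\<kappa> [measurable]:
  "B \<in> sets borel \<Longrightarrow> (\<lambda>\<omega>. emeasure (\<kappa> \<omega>) B) \<in> borel_measurable M"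
  by (rule measurable_compose[OF measurable_prob_algebraD[OF \<kappa>] measurable_emeasure_subprob_algebra])

lemma \<A>_borel: "B \<in> \<A> \<Longrightarrow> B \<in> sets borel"
  using \<A>(3) by (metis sigma_sets.Basic)

lemma UNIV_in_\<A>: "UNIV \<in> \<A>"
  using algebra.top[OF \<A>(2)] .

lemma AE_\<kappa>_permute:
  assumes \<pi>: "\<pi> permutes {..<n}"
  shows "AE \<omega> in M. \<kappa> (\<lambda>i. \<omega> (\<pi> i)) = \<kappa> \<omega>"
  using AE_\<kappa> AE_permute[OF \<pi> AE_\<kappa>]
proof eventually_elim
  fix \<omega>
  assume 1: "\<forall>B\<in>\<A>. convergent (\<lambda>k. freq k B \<omega>) \<and> emeasure (\<kappa> \<omega>) B = ennreal (limit_freq B \<omega>)"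
    and 2: "\<forall>B\<in>\<A>. convergent (\<lambda>k. freq k B (\<lambda>i. \<omega> (\<pi> i))) \<and>
      emeasure (\<kappa> (\<lambda>i. \<omega> (\<pi> i))) B = ennreal (limit_freq B (\<lambda>i. \<omega> (\<pi> i)))"
  show "\<kappa> (\<lambda>i. \<omega> (\<pi> i)) = \<kappa> \<omega>"
  proof (rule measure_eqI_generator_eq[OF algebra.Int_stable[OF \<A>(2)], where A="\<lambda>_. UNIV" and \<Omega>=UNIV])
    show "emeasure (\<kappa> (\<lambda>i. \<omega> (\<pi> i))) B = emeasure (\<kappa> \<omega>) B" if "B \<in> \<A>" for B
      using that 1 2 limit_freq_permute[OF \<pi>, of B \<omega>] by simp
    show "emeasure (\<kappa> (\<lambda>i. \<omega> (\<pi> i))) UNIV \<noteq> \<infinity>" for i :: nat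
      using 2 UNIV_in_\<A> by simp
  qed (auto simp: sets_\<kappa> \<A>(3) UNIV_in_\<A>)
qed

text \<open>
  For \<open>B\<close> in the algebra the value \<open>\<kappa> \<omega> B\<close> is the limiting frequency.  Both sides are finite measures in
  \<open>B\<close>, so the equation extends to all Borel sets.
\<close>

lemma nn_integral_indicator_eq_\<kappa>:
  fixes z :: "(nat \<Rightarrow> 'a) \<Rightarrow> real"
  assumes z_meas [measurable]: "z \<in> borel_measurable M" and B: "B \<in> sets borel"
    and z: "\<And>\<omega>. 0 \<le> z \<omega>" "\<And>\<omega>. z \<omega> \<le> 1"
    and inv: "\<And>j. n \<le> j \<Longrightarrow> AE \<omega> in M. z (\<lambda>i. \<omega> (Transposition.transpose m j i)) = z \<omega>"
  shows "(\<integral>\<^sup>+\<omega>. ennreal (z \<omega>) * indicator B (\<omega> m) \<partial>M) = (\<integral>\<^sup>+\<omega>. ennreal (z \<omega>) * emeasure (\<kappa> \<omega>) B \<partial>M)"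
proof -
  have z': "\<bar>z \<omega>\<bar> \<le> 1" for \<omega> using z[of \<omega>] by simp
  have on_\<A>: "(\<integral>\<^sup>+\<omega>. ennreal (z \<omega>) * indicator B (\<omega> m) \<partial>M) = (\<integral>\<^sup>+\<omega>. ennreal (z \<omega>) * emeasure (\<kappa> \<omega>) B \<partial>M)"
    if "B \<in> \<A>" for B
  proof -
    note [measurable] = \<A>_borel[OF that]
    have pos: "AE \<omega> in M. 0 \<le> limit_freq B \<omega>"
      using AE_\<kappa> by eventually_elim (use that limit_freq_nonneg in auto)
    have int: "integrable M (\<lambda>\<omega>. z \<omega> * limit_freq B \<omega>)"
    proof (rule Bochner_Integration.integrable_bound[OF limit_freq_expectation(1)[of B]])
      show "AE \<omega> in M. norm (z \<omega> * limit_freq B \<omega>) \<le> norm \<bar>limit_freq B \<omega>\<bar>"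
        using z' by (auto simp: abs_mult intro!: mult_left_le_one_le)
    qed auto
    have "(\<integral>\<^sup>+\<omega>. ennreal (z \<omega>) * indicator B (\<omega> m) \<partial>M) = (\<integral>\<^sup>+\<omega>. ennreal (z \<omega> * indicator B (\<omega> m)) \<partial>M)"
      by (intro nn_integral_cong) (auto simp: indicator_def)
    also have "\<dots> = ennreal (expectation (\<lambda>\<omega>. z \<omega> * indicator B (\<omega> m)))"
      by (rule nn_integral_eq_integral, rule integrable_const_bound[where B=1])
        (use z z' in \<open>auto simp: indicator_def\<close>)
    also have "\<dots> = ennreal (expectation (\<lambda>\<omega>. z \<omega> * limit_freq B \<omega>))"
      by (subst expectation_indicator_eq_limit_freq[OF _ _ z' inv]) auto
    also have "\<dots> = (\<integral>\<^sup>+\<omega>. ennreal (z \<omega> * limit_freq B \<omega>) \<partial>M)"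
      by (rule nn_integral_eq_integral[symmetric, OF int]) (use pos z in auto)
    also have "\<dots> = (\<integral>\<^sup>+\<omega>. ennreal (z \<omega>) * emeasure (\<kappa> \<omega>) B \<partial>M)"
    proof (rule nn_integral_cong_AE)
      show "AE \<omega> in M. ennreal (z \<omega> * limit_freq B \<omega>) = ennreal (z \<omega>) * emeasure (\<kappa> \<omega>) B"
        using AE_\<kappa> by eventually_elim (use that z in \<open>simp add: ennreal_mult limit_freq_nonneg\<close>)
    qed
    finally show ?thesis .
  qed
  let ?D = "density M (\<lambda>\<omega>. ennreal (z \<omega>))"
  have [measurable]: "\<kappa> \<in> ?D \<rightarrow>\<^sub>M subprob_algebra borel"
    using measurable_prob_algebraD[OF \<kappa>] by simp
  have distr: "emeasure (distr ?D borel (\<lambda>\<omega>. \<omega> m)) B = (\<integral>\<^sup>+\<omega>. ennreal (z \<omega>) * indicator B (\<omega> m) \<partial>M)"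
    if [measurable]: "B \<in> sets borel" for B
    by (subst emeasure_distr, measurable, subst emeasure_density, measurable)
      (auto intro!: nn_integral_cong simp: indicator_def)
  have bind: "emeasure (?D \<bind> \<kappa>) B = (\<integral>\<^sup>+\<omega>. ennreal (z \<omega>) * emeasure (\<kappa> \<omega>) B \<partial>M)"
    if [measurable]: "B \<in> sets borel" for B
    by (subst emeasure_bind[where N=borel]) (auto simp: nn_integral_density)
  have "distr ?D borel (\<lambda>\<omega>. \<omega> m) = ?D \<bind> \<kappa>"
  proof (rule measure_eqI_generator_eq[OF algebra.Int_stable[OF \<A>(2)], where A="\<lambda>_. UNIV" and \<Omega>=UNIV])
    show "emeasure (distr ?D borel (\<lambda>\<omega>. \<omega> m)) X = emeasure (?D \<bind> \<kappa>) X" if "X \<in> \<A>" for X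
      using that by (simp add: distr bind on_\<A> \<A>_borel)
    show "sets (?D \<bind> \<kappa>) = sigma_sets UNIV \<A>"
      by (subst sets_bind[where N=borel]) (auto simp: sets_\<kappa> \<A>(3))
    have "(\<integral>\<^sup>+\<omega>. ennreal (z \<omega>) * indicator UNIV (\<omega> m) \<partial>M) \<le> (\<integral>\<^sup>+\<omega>. 1 \<partial>M)"
      by (intro nn_integral_mono) (use z in auto)
    also have "\<dots> = 1" using emeasure_space_1 by simp
    finally have "(\<integral>\<^sup>+\<omega>. ennreal (z \<omega>) * indicator UNIV (\<omega> m) \<partial>M) \<noteq> \<infinity>"
      by (auto simp: top_unique)
    then show "emeasure (distr ?D borel (\<lambda>\<omega>. \<omega> m)) UNIV \<noteq> \<infinity>" for i :: nat
      by (subst distr) auto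
  qed (auto simp: \<A>(3) UNIV_in_\<A>)
  then show ?thesis using distr[OF B] bind[OF B] by simp
qed

text \<open>
  The induction moves one index after the other from \<open>J\<close>, where the coordinate itself is tested, to
  \<open>I\<close>, where it has been replaced by the directing measure.  The invariance needed for the step holds
  because \<open>\<kappa>\<close> is almost surely invariant and \<open>J\<close> is bounded.
\<close>

lemma emeasure_cylinder_eq_\<kappa>:
  assumes "finite I" "finite J" "I \<inter> J = {}"
    and A: "\<And>i. A i \<in> sets borel"
  shows "emeasure M {\<omega>. \<forall>i\<in>I \<union> J. \<omega> i \<in> A i}
    = (\<integral>\<^sup>+\<omega>. (\<Prod>i\<in>I. emeasure (\<kappa> \<omega>) (A i)) * (\<Prod>j\<in>J. indicator (A j) (\<omega> j)) \<partial>M)"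
  using assms(1-3)
proof (induction I arbitrary: J rule: finite_induct)
  case empty
  note [measurable] = A
  have ind: "(\<Prod>j\<in>J. indicator (A j) (\<omega> j)) = (indicator {\<omega>. \<forall>i\<in>J. \<omega> i \<in> A i} \<omega> :: ennreal)" for \<omega>
    using \<open>finite J\<close> by (auto simp: indicator_def prod_zero_iff intro: prod.neutral)
  have "{\<omega>\<in>space M. \<forall>i\<in>J. \<omega> i \<in> A i} \<in> sets M" using \<open>finite J\<close> by measurable
  then show ?case by (simp add: ind)
next
  case (insert m I)
  note [measurable] = A
  \<comment> \<open>The factors that the step leaves alone, as a real-valued function with values in the unit interval.\<close>
  define z where "z \<omega> = (\<Prod>i\<in>I. measure (\<kappa> \<omega>) (A i)) * (\<Prod>j\<in>J. indicator (A j) (\<omega> j))" for \<omega>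
  have pr: "measure (\<kappa> \<omega>) X \<le> 1" for \<omega> X using prob_space.prob_le_1[OF prob_\<kappa>] .
  have [measurable]: "(\<lambda>\<omega>. measure (\<kappa> \<omega>) (A i)) \<in> borel_measurable M" for i
    unfolding measure_def by measurable
  have [measurable]: "z \<in> borel_measurable M"
    unfolding z_def by measurable
  have z0: "0 \<le> z \<omega>" for \<omega> unfolding z_def by (intro mult_nonneg_nonneg prod_nonneg) auto
  have z1: "z \<omega> \<le> 1" for \<omega>
  proof -
    have "z \<omega> \<le> 1 * 1" unfolding z_def
      by (intro mult_mono prod_le_1 prod_nonneg) (auto simp: pr indicator_def)
    then show ?thesis by simp
  qed
  have zE: "ennreal (z \<omega>) = (\<Prod>i\<in>I. emeasure (\<kappa> \<omega>) (A i)) * (\<Prod>j\<in>J. indicator (A j) (\<omega> j))" for \<omega>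
  proof -
    have "finite_measure (\<kappa> \<omega>)" using prob_\<kappa> by (rule prob_space.finite_measure)
    then show ?thesis unfolding z_def
      by (simp add: ennreal_mult prod_nonneg prod_ennreal[symmetric] finite_measure.emeasure_eq_measure ennreal_indicator)
  qed
  obtain n where n: "\<And>j. j \<in> J \<Longrightarrow> j < n"
    using \<open>finite J\<close> by (metis finite_nat_set_iff_bounded)
  have inv: "AE \<omega> in M. z (\<lambda>i. \<omega> (Transposition.transpose m j i)) = z \<omega>" if "n \<le> j" for j
  proof -
    have "Transposition.transpose m j permutes {..<m + j + 1}" by (rule permutes_swap_id) auto
    from AE_\<kappa>_permute[OF this] show ?thesis
    proof eventually_elim
      fix \<omega> assume eq: "\<kappa> (\<lambda>i. \<omega> (Transposition.transpose m j i)) = \<kappa> \<omega>"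
      have "Transposition.transpose m j i = i" if "i \<in> J" for i
        using n[OF that] \<open>n \<le> j\<close> that insert.prems by (intro transpose_apply_other) auto
      then show "z (\<lambda>i. \<omega> (Transposition.transpose m j i)) = z \<omega>" by (simp add: z_def eq)
    qed
  qed
  have m: "m \<notin> J" "m \<notin> I" using insert by auto
  have "(\<integral>\<^sup>+\<omega>. (\<Prod>i\<in>insert m I. emeasure (\<kappa> \<omega>) (A i)) * (\<Prod>j\<in>J. indicator (A j) (\<omega> j)) \<partial>M)
      = (\<integral>\<^sup>+\<omega>. ennreal (z \<omega>) * emeasure (\<kappa> \<omega>) (A m) \<partial>M)"
    using m insert.hyps by (simp add: zE mult_ac)
  also have "\<dots> = (\<integral>\<^sup>+\<omega>. ennreal (z \<omega>) * indicator (A m) (\<omega> m) \<partial>M)"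
    by (rule nn_integral_indicator_eq_\<kappa>[symmetric, OF _ _ z0 z1 inv]) auto
  also have "\<dots> = (\<integral>\<^sup>+\<omega>. (\<Prod>i\<in>I. emeasure (\<kappa> \<omega>) (A i)) * (\<Prod>j\<in>insert m J. indicator (A j) (\<omega> j)) \<partial>M)"
    using m insert.prems by (simp add: zE mult_ac)
  also have "\<dots> = emeasure M {\<omega>. \<forall>i\<in>I \<union> insert m J. \<omega> i \<in> A i}"
    by (rule insert.IH[symmetric]) (use m insert.prems in auto)
  finally show ?case by simp
qed

end

text \<open>
  The mixing measure is the distribution of the directing random measure; the cylinder formula with all
  indices replaced identifies the mixture.
\<close>

theorem (in exchangeable_seq) de_Finetti:
  "\<exists>N \<in> space (prob_algebra (prob_algebra borel)). M = N \<bind> (\<lambda>\<mu>. \<Pi>\<^sub>M i\<in>UNIV. \<mu>)"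
proof -
  obtain \<A> :: "'a set set" where \<A>: "countable \<A>" "algebra UNIV \<A>" "sigma_sets UNIV \<A> = sets borel"
    using countable_algebra_generating_borel by auto
  from directing_measure_exists[OF this] obtain \<kappa> where \<kappa>: "\<kappa> \<in> M \<rightarrow>\<^sub>M prob_algebra borel"
    and "AE \<omega> in M. \<forall>B\<in>\<A>. convergent (\<lambda>k. freq k B \<omega>) \<and> emeasure (\<kappa> \<omega>) B = ennreal (limit_freq B \<omega>)"
    by blast
  then interpret directed_exchangeable_seq M \<A> \<kappa>
    by (intro directed_exchangeable_seq.intro exchangeable_seq_axioms directed_exchangeable_seq_axioms.intro \<A>)
  let ?N = "distr M (prob_algebra borel) \<kappa>"
  have N: "?N \<in> space (prob_algebra (prob_algebra borel))"
    using \<kappa> by (simp add: space_prob_algebra prob_space_distr)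
  have iid: "(\<lambda>\<mu>. \<Pi>\<^sub>M i\<in>UNIV. \<mu>) \<in> prob_algebra borel \<rightarrow>\<^sub>M prob_algebra (seq_borel_inf :: (nat \<Rightarrow> 'a) measure)"
    by (rule measurable_PiM_kernel) simp
  have "M = ?N \<bind> (\<lambda>\<mu>. \<Pi>\<^sub>M i\<in>UNIV. \<mu>)"
  proof (rule measure_eqI_PiM_infinite[where I=UNIV and M="\<lambda>_. borel"])
    show "sets (?N \<bind> (\<lambda>\<mu>. \<Pi>\<^sub>M i\<in>UNIV. \<mu>)) = sets seq_borel_inf"
      by (rule sets_bind'[OF N iid])
    fix A :: "nat \<Rightarrow> 'a set" and J :: "nat set"
    assume J: "finite J" and A: "\<And>i. i \<in> J \<Longrightarrow> A i \<in> sets borel"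
    let ?E = "prod_emb UNIV (\<lambda>_. borel) J (Pi\<^sub>E J A)"
    have E: "?E = {\<omega>. \<forall>i\<in>J. \<omega> i \<in> A i}"
      by (auto simp: prod_emb_def PiE_iff restrict_def extensional_def)
    have E_sets: "?E \<in> sets seq_borel_inf" using J A by (intro sets_PiM_I) auto
    have "emeasure (?N \<bind> (\<lambda>\<mu>. \<Pi>\<^sub>M i\<in>UNIV. \<mu>)) ?E = (\<integral>\<^sup>+\<mu>. emeasure (\<Pi>\<^sub>M i\<in>UNIV. \<mu>) ?E \<partial>?N)"
      by (rule emeasure_bind_prob_algebra[OF N iid E_sets])
    also have "\<dots> = (\<integral>\<^sup>+\<omega>. emeasure (\<Pi>\<^sub>M i\<in>UNIV. \<kappa> \<omega>) ?E \<partial>M)"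
      by (rule nn_integral_distr[OF \<kappa>])
        (use measurable_compose[OF measurable_prob_algebraD[OF iid] measurable_emeasure_subprob_algebra[OF E_sets]] in simp)
    also have "\<dots> = (\<integral>\<^sup>+\<omega>. (\<Prod>i\<in>J. emeasure (\<kappa> \<omega>) (A i)) \<partial>M)"
    proof (rule nn_integral_cong)
      fix \<omega>
      have "?E = prod_emb UNIV (\<lambda>_. \<kappa> \<omega>) J (Pi\<^sub>E J A)"
        using sets_\<kappa>[THEN sets_eq_imp_space_eq] by (simp add: prod_emb_def)
      then show "emeasure (\<Pi>\<^sub>M i\<in>UNIV. \<kappa> \<omega>) ?E = (\<Prod>i\<in>J. emeasure (\<kappa> \<omega>) (A i))"
        using J A prob_\<kappa> sets_\<kappa> by (simp add: emeasure_PiM_emb)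
    qed
    also have "\<dots> = emeasure M ?E"
    proof -
      let ?A = "\<lambda>i. if i \<in> J then A i else UNIV"
      have "emeasure M {\<omega>. \<forall>i\<in>J \<union> {}. \<omega> i \<in> ?A i}
        = (\<integral>\<^sup>+\<omega>. (\<Prod>i\<in>J. emeasure (\<kappa> \<omega>) (?A i)) * (\<Prod>j\<in>{}. indicator (?A j) (\<omega> j)) \<partial>M)"
        by (rule emeasure_cylinder_eq_\<kappa>) (use J A in auto)
      then show ?thesis by (simp add: E cong: prod.cong)
    qed
    finally show "emeasure M ?E = emeasure (?N \<bind> (\<lambda>\<mu>. \<Pi>\<^sub>M i\<in>UNIV. \<mu>)) ?E" ..
  qed (auto simp: sets_M finite_measure_axioms)
  with N show ?thesis by blast
qed

section \<open>Infinite products of weights\<close>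

lemma nn_integral_PiM_prod:
  fixes \<mu> :: "'a::polish_space measure"
  assumes \<mu>: "prob_space \<mu>" "sets \<mu> = sets borel" and g: "\<And>i. g i \<in> borel_measurable borel"
  shows "(\<integral>\<^sup>+\<omega>. (\<Prod>i<k. g i (\<omega> i)) \<partial>(\<Pi>\<^sub>M i\<in>(UNIV::nat set). \<mu>)) = (\<Prod>i<k. \<integral>\<^sup>+x. g i x \<partial>\<mu>)"
proof -
  interpret prob_space \<mu> by fact
  interpret product_prob_space "\<lambda>_::nat. \<mu>" UNIV by unfold_locales
  have [measurable]: "g i \<in> borel_measurable \<mu>" for i using g \<mu>(2) by (simp cong: measurable_cong_sets)
  have "(\<integral>\<^sup>+x. (\<Prod>i<k. g i (x i)) \<partial>(\<Pi>\<^sub>M i\<in>{..<k}. \<mu>)) = (\<Prod>i<k. \<integral>\<^sup>+x. g i x \<partial>\<mu>)"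
    by (rule product_nn_integral_prod) auto
  moreover have "(\<integral>\<^sup>+x. (\<Prod>i<k. g i (x i)) \<partial>(\<Pi>\<^sub>M i\<in>{..<k}. \<mu>))
      = (\<integral>\<^sup>+x. (\<Prod>i<k. g i (x i)) \<partial>distr (\<Pi>\<^sub>M i\<in>UNIV. \<mu>) (\<Pi>\<^sub>M i\<in>{..<k}. \<mu>) (\<lambda>x. restrict x {..<k}))"
    by (subst distr_PiM_restrict_finite) auto
  moreover have "\<dots> = (\<integral>\<^sup>+\<omega>. (\<Prod>i<k. g i (\<omega> i)) \<partial>(\<Pi>\<^sub>M i\<in>UNIV. \<mu>))"
    by (subst nn_integral_distr) (auto intro!: nn_integral_cong prod.cong)
  ultimately show ?thesis by simp
qed

locale summable_weights =
  fixes w :: "nat \<Rightarrow> 'a::polish_space \<Rightarrow> real" and r :: "nat \<Rightarrow> real"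
  assumes w_meas [measurable]: "\<And>i. w i \<in> borel_measurable borel"
    and r_pos: "\<And>i. 0 < r i" and r_le_w: "\<And>i x. r i \<le> w i x" and w_le_1: "\<And>i x. w i x \<le> 1"
    and summable_r: "summable (\<lambda>i. 1 - r i)"
begin

lemma w_pos: "0 < w i x"
  using r_pos[of i] r_le_w[of i x] by simp

definition partial_weight :: "nat \<Rightarrow> (nat \<Rightarrow> 'a) \<Rightarrow> real" where
  "partial_weight n \<omega> = (\<Prod>i<n. w i (\<omega> i))"

definition total_weight :: "(nat \<Rightarrow> 'a) \<Rightarrow> real" where
  "total_weight \<omega> = lim (\<lambda>n. partial_weight n \<omega>)"

definition lower :: real where
  "lower = prodinf r"

text \<open>
  This is where summability of the defects enters: an infinite product of positive factors \<open>r i \<le> 1\<close>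
  with summable defects does not vanish.
\<close>

lemma prod_r_bounds: "0 < lower" "lower \<le> (\<Prod>i<n. r i)"
proof -
  have r1: "r i \<le> 1" for i using r_le_w w_le_1 by (meson order_trans)
  have "convergent_prod (\<lambda>i. 1 + (r i - 1))"
  proof (rule summable_imp_convergent_prod_real)
    have "\<bar>r k - 1\<bar> = 1 - r k" for k using r1[of k] by simp
    then show "summable (\<lambda>k. \<bar>r k - 1\<bar>)" using summable_r by simp
    show "r k - 1 \<noteq> - 1" for k using r_pos[of k] by simp
  qed
  then have conv: "convergent_prod r" by simp
  have "decseq (\<lambda>n. \<Prod>i\<le>n. r i)"
    unfolding decseq_Suc_iff using r1 r_pos by (simp add: mult_left_le prod_nonneg less_imp_le)
  then have le: "lower \<le> (\<Prod>i\<le>n. r i)" for n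
    unfolding lower_def by (rule decseq_ge) (rule convergent_prod_LIMSEQ[OF conv])
  have "0 \<le> lower" unfolding lower_def
    by (rule LIMSEQ_le_const[OF convergent_prod_LIMSEQ[OF conv]]) (use r_pos in \<open>simp add: prod_nonneg less_imp_le\<close>)
  moreover have "lower \<noteq> 0" unfolding lower_def
    using r_pos by (intro prodinf_nonzero conv) (metis less_irrefl)
  ultimately show "0 < lower" by simp
  have "(\<Prod>i\<le>n. r i) \<le> (\<Prod>i<n. r i)"
    using r1 r_pos by (simp add: lessThan_Suc_atMost[symmetric] mult_left_le prod_nonneg less_imp_le)
  with le[of n] show "lower \<le> (\<Prod>i<n. r i)" by simp
qed

lemma lower_le_partial: "lower \<le> partial_weight n \<omega>"
proof -
  have "(\<Prod>i<n. r i) \<le> partial_weight n \<omega>"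
    unfolding partial_weight_def using r_pos r_le_w by (intro prod_mono) (auto intro: less_imp_le)
  with prod_r_bounds(2)[of n] show ?thesis by simp
qed

lemma partial_pos: "0 < partial_weight n \<omega>"
  using prod_r_bounds(1) lower_le_partial by (rule less_le_trans)

lemma partial_le_1: "partial_weight n \<omega> \<le> 1"
  unfolding partial_weight_def using w_pos w_le_1 by (intro prod_le_1) (auto intro: less_imp_le)

lemma partial_tendsto_total: "(\<lambda>n. partial_weight n \<omega>) \<longlonglongrightarrow> total_weight \<omega>"
proof -
  have "decseq (\<lambda>n. partial_weight n \<omega>)"
    unfolding decseq_Suc_iff using partial_pos[of _ \<omega>] w_le_1 w_pos
    by (simp add: partial_weight_def mult_left_le less_imp_le)
  then have "convergent (\<lambda>n. partial_weight n \<omega>)"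
    using lower_le_partial by (metis decseq_convergent convergentI)
  then show ?thesis by (simp add: total_weight_def convergent_LIMSEQ_iff)
qed

lemma lower_le_total: "lower \<le> total_weight \<omega>"
  by (rule LIMSEQ_le_const[OF partial_tendsto_total]) (auto simp: lower_le_partial)

lemma total_pos: "0 < total_weight \<omega>"
  using prod_r_bounds(1) lower_le_total by (rule less_le_trans)

lemma total_le_1: "total_weight \<omega> \<le> 1"
  by (rule LIMSEQ_le_const2[OF partial_tendsto_total]) (auto simp: partial_le_1)

lemma measurable_partial_weight [measurable]: "partial_weight n \<in> borel_measurable seq_borel_inf"
  unfolding partial_weight_def by measurable

lemma measurable_total_weight [measurable]: "total_weight \<in> borel_measurable seq_borel_inf"
  by (rule borel_measurable_LIMSEQ_real[OF partial_tendsto_total]) measurable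

lemma nn_integral_inverse_weight_tendsto:
  assumes "prob_space P" and [measurable_cong]: "sets P = sets seq_borel_inf" and E: "{\<omega>. Q \<omega>} \<in> sets seq_borel_inf"
  shows "(\<lambda>k. \<integral>\<^sup>+\<omega>. ennreal (1 / partial_weight k \<omega>) * indicator {\<omega>. Q \<omega>} \<omega> \<partial>P)
    \<longlonglongrightarrow> (\<integral>\<^sup>+\<omega>. ennreal (1 / total_weight \<omega>) * indicator {\<omega>. Q \<omega>} \<omega> \<partial>P)"
proof (rule nn_integral_dominated_convergence[where w="\<lambda>_. ennreal (1 / lower)"])
  interpret prob_space P by fact
  note [measurable] = E
  show "AE \<omega> in P. ennreal (1 / partial_weight k \<omega>) * indicator {\<omega>. Q \<omega>} \<omega> \<le> ennreal (1 / lower)" for k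
    using lower_le_partial prod_r_bounds(1) partial_pos
    by (auto simp: indicator_def intro!: AE_I2 ennreal_leI frac_le)
  show "(\<integral>\<^sup>+\<omega>. ennreal (1 / lower) \<partial>P) < \<infinity>" by (simp add: emeasure_space_1)
  have "(\<lambda>k. 1 / partial_weight k \<omega>) \<longlonglongrightarrow> 1 / total_weight \<omega>" for \<omega>
    using total_pos[of \<omega>] by (intro tendsto_divide tendsto_const partial_tendsto_total) auto
  then show "AE \<omega> in P. (\<lambda>k. ennreal (1 / partial_weight k \<omega>) * indicator {\<omega>. Q \<omega>} \<omega>)
      \<longlonglongrightarrow> ennreal (1 / total_weight \<omega>) * indicator {\<omega>. Q \<omega>} \<omega>"
    by (auto simp: indicator_def intro!: AE_I2 tendsto_ennrealI)
  show "(\<lambda>\<omega>. ennreal (1 / partial_weight k \<omega>) * indicator {\<omega>. Q \<omega>} \<omega>) \<in> borel_measurable P" for k by measurable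
  show "(\<lambda>\<omega>. ennreal (1 / total_weight \<omega>) * indicator {\<omega>. Q \<omega>} \<omega>) \<in> borel_measurable P" by measurable
qed auto

text \<open>
  The second part identifies \<open>w i\<close> times \<open>\<mu>\<close> as the tilted measure times its normalising constant.
\<close>

lemma tilt_weight:
  assumes \<mu>: "prob_space \<mu>" "sets \<mu> = sets borel"
  shows "prob_space (tilt (w i) \<mu>)"
    and "A \<in> sets borel \<Longrightarrow> (\<integral>\<^sup>+x. ennreal (w i x) * indicator A x \<partial>\<mu>) = (\<integral>\<^sup>+x. ennreal (w i x) \<partial>\<mu>) * emeasure (tilt (w i) \<mu>) A"
proof -
  interpret prob_space \<mu> by fact
  note [measurable_cong] = \<mu>(2)
  have int: "integrable \<mu> (w i)"
    using w_pos w_le_1 by (intro integrable_const_bound[where B=1]) (auto intro!: AE_I2 simp: less_imp_le)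
  let ?I = "\<integral>x. w i x \<partial>\<mu>"
  have "r i \<le> ?I"
  proof -
    have "(\<integral>x. r i \<partial>\<mu>) \<le> ?I" by (intro integral_mono int r_le_w) auto
    then show ?thesis by (simp add: prob_space)
  qed
  then have I: "0 < ?I" using r_pos[of i] by simp
  have nn: "(\<integral>\<^sup>+x. ennreal (w i x) \<partial>\<mu>) = ennreal ?I"
    using w_pos by (intro nn_integral_eq_integral int) (auto intro!: AE_I2 less_imp_le)
  have em: "(\<integral>\<^sup>+x. ennreal (w i x) * indicator A x \<partial>\<mu>) = ennreal ?I * emeasure (tilt (w i) \<mu>) A"
    if [measurable]: "A \<in> sets borel" for A
  proof -
    have "(\<integral>\<^sup>+x. ennreal (w i x) * indicator A x \<partial>\<mu>) = (\<integral>\<^sup>+x. ennreal ?I * (ennreal (w i x / ?I) * indicator A x) \<partial>\<mu>)"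
      using I w_pos[of i] by (intro nn_integral_cong)
        (auto simp: mult.assoc[symmetric] ennreal_mult[symmetric] less_imp_le)
    also have "\<dots> = ennreal ?I * emeasure (tilt (w i) \<mu>) A"
      unfolding tilt_def by (subst nn_integral_cmult, measurable, subst emeasure_density) auto
    finally show ?thesis .
  qed
  then show "A \<in> sets borel \<Longrightarrow> (\<integral>\<^sup>+x. ennreal (w i x) * indicator A x \<partial>\<mu>) = (\<integral>\<^sup>+x. ennreal (w i x) \<partial>\<mu>) * emeasure (tilt (w i) \<mu>) A"
    by (simp add: nn)
  have sp: "space \<mu> = UNIV" using sets_eq_imp_space_eq[OF \<mu>(2)] by simp
  have "emeasure (tilt (w i) \<mu>) (space (tilt (w i) \<mu>)) = (\<integral>\<^sup>+x. ennreal (w i x / ?I) \<partial>\<mu>)"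
    by (simp add: tilt_def emeasure_density sp)
  also have "\<dots> = ennreal (\<integral>x. w i x / ?I \<partial>\<mu>)"
    using I w_pos int by (intro nn_integral_eq_integral) (auto intro!: AE_I2 less_imp_le)
  also have "\<dots> = 1" using I by simp
  finally show "prob_space (tilt (w i) \<mu>)" by (rule prob_spaceI)
qed

lemma sets_weighted_iid: "sets \<mu> = sets borel \<Longrightarrow> sets (weighted_iid w \<mu>) = sets seq_borel_inf"
  unfolding weighted_iid_def tilt_def by (intro sets_PiM_cong) auto

text \<open>
  A density that is a product over the coordinates turns a product measure into a product
  measure, so weighting \<open>\<mu>\<^sup>\<infinity>\<close> by the total weight gives the weighted i.i.d. measure up to its mass \<open>Z\<close>.
  For infinitely many factors this is obtained as a limit over finite partial products; it is
  non-degenerate because \<open>Z\<close> is bounded below by the positive number \<open>lower\<close>.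
\<close>

lemma total_weight_density_iid:
  assumes \<mu>: "prob_space \<mu>" "sets \<mu> = sets borel"
  defines "\<nu> \<equiv> \<Pi>\<^sub>M i\<in>(UNIV::nat set). \<mu>"
  defines "Z \<equiv> \<integral>\<^sup>+\<omega>. ennreal (total_weight \<omega>) \<partial>\<nu>"
  shows "0 < Z" "Z \<le> 1"
    and "A \<in> sets seq_borel_inf \<Longrightarrow>
      (\<integral>\<^sup>+\<omega>. ennreal (total_weight \<omega>) * indicator A \<omega> \<partial>\<nu>) = Z * emeasure (weighted_iid w \<mu>) A"
proof -
  have sets_\<nu> [measurable_cong]: "sets \<nu> = sets seq_borel_inf"
    unfolding \<nu>_def using \<mu>(2) by (intro sets_PiM_cong) auto
  interpret \<nu>: prob_space \<nu> unfolding \<nu>_def using \<mu>(1) by (rule prob_space_PiM)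
  have space_\<nu>: "space \<nu> = UNIV" using sets_eq_imp_space_eq[OF sets_\<nu>] by (simp add: space_PiM)
  have "(\<integral>\<^sup>+\<omega>. ennreal lower \<partial>\<nu>) \<le> Z" unfolding Z_def
    by (intro nn_integral_mono ennreal_leI lower_le_total)
  then have "ennreal lower \<le> Z" by (simp add: \<nu>.emeasure_space_1)
  then show Z0: "0 < Z" using prod_r_bounds(1) by (metis ennreal_less_zero_iff less_le_trans)
  have "Z \<le> (\<integral>\<^sup>+\<omega>. 1 \<partial>\<nu>)" unfolding Z_def
    by (intro nn_integral_mono) (simp add: total_le_1)
  then show Z1: "Z \<le> 1" by (simp add: \<nu>.emeasure_space_1)
  \<comment> \<open>The finite products factorise coordinatewise; the limit is taken on cylinders.\<close>
  have cyl: "(\<integral>\<^sup>+\<omega>. ennreal (total_weight \<omega>) * indicator {\<omega>. \<forall>i\<in>J. \<omega> i \<in> F i} \<omega> \<partial>\<nu>)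
      = Z * (\<Prod>i\<in>J. emeasure (tilt (w i) \<mu>) (F i))"
    if J: "finite J" and F: "\<And>i. i \<in> J \<Longrightarrow> F i \<in> sets borel" for J F
  proof -
    let ?E = "{\<omega>. \<forall>i\<in>J. \<omega> i \<in> F i}" and ?F = "\<lambda>i. if i \<in> J then F i else UNIV"
    have F': "?F i \<in> sets borel" for i using F by auto
    have [measurable]: "?E \<in> sets seq_borel_inf"
    proof -
      have "{\<omega>\<in>space seq_borel_inf. \<forall>i\<in>J. \<omega> i \<in> F i} \<in> sets seq_borel_inf"
        using J F by measurable
      then show ?thesis by (simp add: space_PiM)
    qed
    have lim: "(\<lambda>k. \<integral>\<^sup>+\<omega>. ennreal (partial_weight k \<omega>) * indicator E \<omega> \<partial>\<nu>)
        \<longlonglongrightarrow> (\<integral>\<^sup>+\<omega>. ennreal (total_weight \<omega>) * indicator E \<omega> \<partial>\<nu>)"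
      if [measurable]: "E \<in> sets seq_borel_inf" for E
    proof (rule nn_integral_dominated_convergence[where w="\<lambda>_. 1"])
      show "AE \<omega> in \<nu>. ennreal (partial_weight k \<omega>) * indicator E \<omega> \<le> 1" for k
        by (auto simp: indicator_def partial_le_1)
      show "AE \<omega> in \<nu>. (\<lambda>k. ennreal (partial_weight k \<omega>) * indicator E \<omega>)
          \<longlonglongrightarrow> ennreal (total_weight \<omega>) * indicator E \<omega>"
        by (auto simp: indicator_def intro!: AE_I2 tendsto_ennrealI partial_tendsto_total)
    qed (auto simp: \<nu>.emeasure_space_1)
    obtain n where n: "J \<subseteq> {..<n}" using J by (metis finite_nat_iff_bounded)
    let ?I = "\<lambda>k. \<Prod>i<k. \<integral>\<^sup>+x. ennreal (w i x) \<partial>\<mu>"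
    let ?T = "\<Prod>i\<in>J. emeasure (tilt (w i) \<mu>) (F i)"
    have eq: "(\<integral>\<^sup>+\<omega>. ennreal (partial_weight k \<omega>) * indicator ?E \<omega> \<partial>\<nu>) = ?I k * ?T" if "n \<le> k" for k
    proof -
      have ind: "ennreal (partial_weight k \<omega>) * indicator ?E \<omega> = (\<Prod>i<k. ennreal (w i (\<omega> i)) * indicator (?F i) (\<omega> i))" for \<omega>
      proof -
        have "(\<Prod>i<k. indicator (?F i) (\<omega> i)) = (indicator ?E \<omega> :: ennreal)"
        proof (cases "\<omega> \<in> ?E")
          case True
          then show ?thesis by (auto intro!: prod.neutral simp: indicator_def)
        next
          case False
          then obtain i where "i \<in> J" "\<omega> i \<notin> F i" by auto
          then have "\<exists>i\<in>{..<k}. indicator (?F i) (\<omega> i) = (0::ennreal)"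
            using n that by (intro bexI[of _ i]) auto
          then have "(\<Prod>i<k. indicator (?F i) (\<omega> i)) = (0::ennreal)" by (intro prod_zero) auto
          with False show ?thesis by simp
        qed
        then show ?thesis
          using w_pos by (simp add: prod.distrib partial_weight_def prod_ennreal less_imp_le)
      qed
      have "(\<integral>\<^sup>+\<omega>. (\<Prod>i<k. ennreal (w i (\<omega> i)) * indicator (?F i) (\<omega> i)) \<partial>\<nu>)
          = (\<Prod>i<k. \<integral>\<^sup>+x. ennreal (w i x) * indicator (?F i) x \<partial>\<mu>)"
        unfolding \<nu>_def
        by (rule nn_integral_PiM_prod[OF \<mu>, where g="\<lambda>i x. ennreal (w i x) * indicator (?F i) x"],
            intro borel_measurable_times_ennreal borel_measurable_indicator F') measurable
      also have "\<dots> = (\<Prod>i<k. (\<integral>\<^sup>+x. ennreal (w i x) \<partial>\<mu>) * emeasure (tilt (w i) \<mu>) (?F i))"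
        by (intro prod.cong refl tilt_weight(2)[OF \<mu>] F')
      also have "\<dots> = ?I k * (\<Prod>i<k. emeasure (tilt (w i) \<mu>) (?F i))" by (rule prod.distrib)
      also have "(\<Prod>i<k. emeasure (tilt (w i) \<mu>) (?F i)) = ?T"
      proof (rule prod.mono_neutral_cong_right)
        show "\<forall>i\<in>{..<k} - J. emeasure (tilt (w i) \<mu>) (?F i) = 1"
        proof
          fix i assume "i \<in> {..<k} - J"
          have "space (tilt (w i) \<mu>) = UNIV" using sets_eq_imp_space_eq[OF \<mu>(2)] by (simp add: tilt_def)
          then show "emeasure (tilt (w i) \<mu>) (?F i) = 1"
            using prob_space.emeasure_space_1[OF tilt_weight(1)[OF \<mu>], of i] \<open>i \<in> {..<k} - J\<close> by simp
        qed
      qed (use n that in auto)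
      finally show ?thesis unfolding ind .
    qed
    have "?I k = (\<integral>\<^sup>+\<omega>. ennreal (partial_weight k \<omega>) * indicator UNIV \<omega> \<partial>\<nu>)" for k
      using nn_integral_PiM_prod[OF \<mu>, of "\<lambda>i x. ennreal (w i x)" k] w_pos
      by (simp add: \<nu>_def partial_weight_def prod_ennreal less_imp_le)
    then have "?I \<longlonglongrightarrow> Z" using lim[of UNIV] sets.top[of seq_borel_inf] by (simp add: Z_def space_PiM)
    moreover have "?T \<noteq> \<top>"
    proof -
      have "emeasure (tilt (w i) \<mu>) X \<noteq> \<top>" for i X
        using prob_space.finite_measure[OF tilt_weight(1)[OF \<mu>]] finite_measure.emeasure_finite by auto
      then show ?thesis by (simp add: ennreal_prod_eq_top)
    qed
    ultimately have "(\<lambda>k. ?I k * ?T) \<longlonglongrightarrow> Z * ?T"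
      by (intro tendsto_mult_ennreal tendsto_const) (use Z0 Z1 in \<open>auto simp: top_unique\<close>)
    then have "(\<lambda>k. \<integral>\<^sup>+\<omega>. ennreal (partial_weight k \<omega>) * indicator ?E \<omega> \<partial>\<nu>) \<longlonglongrightarrow> Z * ?T"
      by (rule Lim_transform_eventually) (use eq in \<open>auto simp: eventually_sequentially intro!: exI[of _ n]\<close>)
    then show ?thesis using LIMSEQ_unique[OF lim] by simp
  qed
  interpret T: prob_space "tilt (w i) \<mu>" for i by (rule tilt_weight(1)[OF \<mu>])
  interpret T: product_prob_space "\<lambda>i. tilt (w i) \<mu>" UNIV by unfold_locales
  let ?D = "density \<nu> (\<lambda>\<omega>. ennreal (total_weight \<omega>) / Z)"
  have em: "emeasure ?D E = (\<integral>\<^sup>+\<omega>. ennreal (total_weight \<omega>) * indicator E \<omega> \<partial>\<nu>) / Z"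
    if [measurable]: "E \<in> sets seq_borel_inf" for E
  proof -
    have "emeasure ?D E = (\<integral>\<^sup>+\<omega>. (ennreal (total_weight \<omega>) * indicator E \<omega>) / Z \<partial>\<nu>)"
      by (subst emeasure_density) (auto intro!: nn_integral_cong simp: ennreal_times_divide mult.commute)
    then show ?thesis by (simp add: nn_integral_divide)
  qed
  have cancel: "Z * t / Z = t" for t
  proof -
    have "Z \<noteq> 0" using Z0 by simp
    moreover have "Z \<noteq> \<top>" using Z1 by (auto simp: top_unique)
    ultimately show ?thesis using mult_divide_eq_ennreal[of Z t] by (simp add: mult.commute)
  qed
  have "?D = weighted_iid w \<mu>"
    unfolding weighted_iid_def
  proof (rule T.PiM_eq)
    show "sets ?D = sets (\<Pi>\<^sub>M i\<in>UNIV. tilt (w i) \<mu>)"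
      using sets_weighted_iid[OF \<mu>(2)] sets_\<nu> by (simp add: weighted_iid_def)
    fix J :: "nat set" and F assume J: "finite J" and F: "\<And>j. j \<in> J \<Longrightarrow> F j \<in> sets (tilt (w j) \<mu>)"
    have F': "F j \<in> sets borel" if "j \<in> J" for j using F[OF that] \<mu>(2) by (simp add: tilt_def)
    let ?E = "prod_emb UNIV (\<lambda>i. tilt (w i) \<mu>) J (Pi\<^sub>E J F)"
    have sp: "space (tilt (w i) \<mu>) = UNIV" for i using sets_eq_imp_space_eq[OF \<mu>(2)] by (simp add: tilt_def)
    have E: "?E = {\<omega>. \<forall>i\<in>J. \<omega> i \<in> F i}"
      by (auto simp: prod_emb_def PiE_iff restrict_def extensional_def sp)
    have "?E \<in> sets (\<Pi>\<^sub>M i\<in>UNIV. tilt (w i) \<mu>)" using J F by (intro sets_PiM_I) auto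
    then have E_sets: "?E \<in> sets seq_borel_inf" using sets_weighted_iid[OF \<mu>(2)] by (simp add: weighted_iid_def)
    have "emeasure ?D ?E = Z * (\<Prod>i\<in>J. emeasure (tilt (w i) \<mu>) (F i)) / Z"
      unfolding em[OF E_sets] unfolding E using cyl[OF J F'] by simp
    then show "emeasure ?D ?E = (\<Prod>i\<in>J. emeasure (tilt (w i) \<mu>) (F i))"
      by (simp only: cancel)
  qed
  then show "(\<integral>\<^sup>+\<omega>. ennreal (total_weight \<omega>) * indicator A \<omega> \<partial>\<nu>) = Z * emeasure (weighted_iid w \<mu>) A"
    if "A \<in> sets seq_borel_inf"
    using em[OF that] by (simp add: ennreal_times_divide cancel)
qed

end

section \<open>Weighted exchangeable sequences\<close>

context summable_weights
begin

text \<open>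
  Weighted exchangeability of all marginals, expressed on sequence space for cylinder events and in terms of the
  normalised weights.  The equation is homogeneous in the density, so the normalising constants cancel.
\<close>

definition unweighted_symmetric :: "(nat \<Rightarrow> 'a) measure \<Rightarrow> bool" where
  "unweighted_symmetric P \<longleftrightarrow> (\<forall>k\<ge>1. \<forall>\<pi> J A. \<pi> permutes {..<k} \<longrightarrow> J \<subseteq> {..<k} \<longrightarrow> (\<forall>i. A i \<in> sets borel) \<longrightarrow>
     (\<integral>\<^sup>+\<omega>. ennreal (1 / partial_weight k \<omega>) * indicator {\<omega>. \<forall>i\<in>J. \<omega> (\<pi> i) \<in> A i} \<omega> \<partial>P) =
     (\<integral>\<^sup>+\<omega>. ennreal (1 / partial_weight k \<omega>) * indicator {\<omega>. \<forall>i\<in>J. \<omega> i \<in> A i} \<omega> \<partial>P))"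

definition mass :: "(nat \<Rightarrow> 'a) measure \<Rightarrow> ennreal" where
  "mass P = (\<integral>\<^sup>+\<omega>. ennreal (1 / total_weight \<omega>) \<partial>P)"

definition reweighted :: "(nat \<Rightarrow> 'a) measure \<Rightarrow> (nat \<Rightarrow> 'a) measure" where
  "reweighted P = density P (\<lambda>\<omega>. ennreal (1 / total_weight \<omega>) / mass P)"

lemma mass_bounds:
  assumes "prob_space P"
  shows "mass P \<noteq> 0" "mass P \<noteq> \<top>"
proof -
  interpret prob_space P by fact
  have "(\<integral>\<^sup>+\<omega>. 1 \<partial>P) \<le> mass P" unfolding mass_def
    using total_pos total_le_1 by (intro nn_integral_mono) auto
  then show "mass P \<noteq> 0" by (auto simp: emeasure_space_1)
  have "mass P \<le> (\<integral>\<^sup>+\<omega>. ennreal (1 / lower) \<partial>P)" unfolding mass_def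
    using lower_le_total prod_r_bounds(1) by (intro nn_integral_mono ennreal_leI frac_le) auto
  then show "mass P \<noteq> \<top>" by (auto simp: emeasure_space_1 top_unique)
qed

lemma emeasure_reweighted:
  assumes [measurable_cong]: "sets P = sets seq_borel_inf" and [measurable]: "E \<in> sets seq_borel_inf"
  shows "emeasure (reweighted P) E = (\<integral>\<^sup>+\<omega>. ennreal (1 / total_weight \<omega>) * indicator E \<omega> \<partial>P) / mass P"
proof -
  have "emeasure (reweighted P) E = (\<integral>\<^sup>+\<omega>. (ennreal (1 / total_weight \<omega>) * indicator E \<omega>) / mass P \<partial>P)"
    unfolding reweighted_def
    by (subst emeasure_density) (auto intro!: nn_integral_cong simp: ennreal_times_divide mult.commute)
  then show ?thesis by (simp add: nn_integral_divide)
qed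

lemma density_reweighted:
  assumes "prob_space P" and [measurable_cong]: "sets P = sets seq_borel_inf"
  shows "density (reweighted P) (\<lambda>\<omega>. mass P * ennreal (total_weight \<omega>)) = P"
proof -
  have one: "ennreal (1 / total_weight \<omega>) / mass P * (mass P * ennreal (total_weight \<omega>)) = 1" for \<omega>
  proof -
    have "ennreal (1 / total_weight \<omega>) / mass P * mass P = ennreal (1 / total_weight \<omega>)"
      using mass_bounds[OF assms(1)] by (simp add: ennreal_divide_times ennreal_divide_self less_top)
    then have "ennreal (1 / total_weight \<omega>) / mass P * (mass P * ennreal (total_weight \<omega>))
        = ennreal (1 / total_weight \<omega>) * ennreal (total_weight \<omega>)"
      by (simp add: mult.assoc[symmetric])
    also have "\<dots> = 1"
      using total_pos[of \<omega>] by (simp add: ennreal_mult[symmetric] less_imp_le)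
    finally show ?thesis .
  qed
  have "density (reweighted P) (\<lambda>\<omega>. mass P * ennreal (total_weight \<omega>)) = density P (\<lambda>\<omega>. 1)"
    unfolding reweighted_def by (subst density_density_eq) (measurable, simp add: one)
  then show ?thesis by (simp add: density_1)
qed

text \<open>
  The invariance holds with the partial weight \<open>partial_weight k\<close> for every large \<open>k\<close>, and the
  reciprocals of the partial weights are bounded by \<open>1 / lower\<close>, so it passes to the limit.
\<close>

lemma exchangeable_reweighted:
  assumes P: "prob_space P" and sets_P [measurable_cong]: "sets P = sets seq_borel_inf"
    and sym: "unweighted_symmetric P"
  shows "exchangeable_seq (reweighted P)"
proof -
  have sets_Q [measurable_cong]: "sets (reweighted P) = sets seq_borel_inf"
    using sets_P by (simp add: reweighted_def)
  have space_Q: "space (reweighted P) = UNIV"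
    using sets_eq_imp_space_eq[OF sets_Q] by (simp add: space_PiM)
  have "emeasure (reweighted P) UNIV = mass P / mass P"
    using emeasure_reweighted[OF sets_P, of UNIV] sets.top[of seq_borel_inf]
    by (simp add: mass_def space_PiM)
  then have "emeasure (reweighted P) UNIV = 1"
    using mass_bounds[OF P] by (simp add: ennreal_divide_self less_top)
  then interpret Q: prob_space "reweighted P" by (intro prob_spaceI) (simp add: space_Q)
  have "distr (reweighted P) seq_borel_inf (\<lambda>\<omega> i. \<omega> (\<pi> i)) = reweighted P"
    if \<pi>: "\<pi> permutes {..<n}" for n \<pi>
  proof (rule measure_eqI_PiM_infinite[where I=UNIV and M="\<lambda>_. borel"])
    have perm: "(\<lambda>\<omega> i. \<omega> (\<pi> i)) \<in> reweighted P \<rightarrow>\<^sub>M seq_borel_inf"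
      by (rule measurable_PiM_single') auto
    fix A :: "nat \<Rightarrow> 'a set" and J :: "nat set"
    assume J: "finite J" and A: "\<And>i. i \<in> J \<Longrightarrow> A i \<in> sets borel"
    let ?A = "\<lambda>i. if i \<in> J then A i else UNIV"
    have A': "?A i \<in> sets borel" for i using A by auto
    let ?E = "prod_emb UNIV (\<lambda>_. borel) J (Pi\<^sub>E J A)"
    let ?E\<pi> = "{\<omega>. \<forall>i\<in>J. \<omega> (\<pi> i) \<in> ?A i}"
    have E: "?E = {\<omega>. \<forall>i\<in>J. \<omega> i \<in> ?A i}"
      by (auto simp: prod_emb_def PiE_iff restrict_def extensional_def)
    have E_sets [measurable]: "?E \<in> sets seq_borel_inf" using J A by (intro sets_PiM_I) auto
    have vimage: "(\<lambda>\<omega> i. \<omega> (\<pi> i)) -` ?E \<inter> space (reweighted P) = ?E\<pi>"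
      by (auto simp: E space_Q)
    have E\<pi>_sets: "?E\<pi> \<in> sets seq_borel_inf"
      using measurable_sets[OF perm E_sets] vimage sets_Q by simp
    obtain m where m: "J \<subseteq> {..<m}" using J by (metis finite_nat_iff_bounded)
    have "(\<integral>\<^sup>+\<omega>. ennreal (1 / total_weight \<omega>) * indicator ?E\<pi> \<omega> \<partial>P)
        = (\<integral>\<^sup>+\<omega>. ennreal (1 / total_weight \<omega>) * indicator {\<omega>. \<forall>i\<in>J. \<omega> i \<in> ?A i} \<omega> \<partial>P)"
    proof (rule LIMSEQ_unique)
      show "(\<lambda>k. \<integral>\<^sup>+\<omega>. ennreal (1 / partial_weight k \<omega>) * indicator {\<omega>. \<forall>i\<in>J. \<omega> i \<in> ?A i} \<omega> \<partial>P)
          \<longlonglongrightarrow> (\<integral>\<^sup>+\<omega>. ennreal (1 / total_weight \<omega>) * indicator {\<omega>. \<forall>i\<in>J. \<omega> i \<in> ?A i} \<omega> \<partial>P)"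
        by (rule nn_integral_inverse_weight_tendsto[OF P sets_P]) (use E_sets E in simp)
      have eq: "(\<integral>\<^sup>+\<omega>. ennreal (1 / partial_weight k \<omega>) * indicator ?E\<pi> \<omega> \<partial>P)
          = (\<integral>\<^sup>+\<omega>. ennreal (1 / partial_weight k \<omega>) * indicator {\<omega>. \<forall>i\<in>J. \<omega> i \<in> ?A i} \<omega> \<partial>P)"
        if k: "max 1 (max m n) \<le> k" for k
      proof -
        have "\<pi> permutes {..<k}" by (rule permutes_subset[OF \<pi>]) (use k in auto)
        moreover have "J \<subseteq> {..<k}" using m k by auto
        moreover have "1 \<le> k" using k by simp
        ultimately show ?thesis
          by (intro sym[unfolded unweighted_symmetric_def, rule_format] A')
      qed
      have "\<forall>\<^sub>F k in sequentially. (\<integral>\<^sup>+\<omega>. ennreal (1 / partial_weight k \<omega>) * indicator ?E\<pi> \<omega> \<partial>P)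
          = (\<integral>\<^sup>+\<omega>. ennreal (1 / partial_weight k \<omega>) * indicator {\<omega>. \<forall>i\<in>J. \<omega> i \<in> ?A i} \<omega> \<partial>P)"
        using eventually_ge_at_top[of "max 1 (max m n)"] by (rule eventually_mono) (rule eq)
      then show "(\<lambda>k. \<integral>\<^sup>+\<omega>. ennreal (1 / partial_weight k \<omega>) * indicator {\<omega>. \<forall>i\<in>J. \<omega> i \<in> ?A i} \<omega> \<partial>P)
          \<longlonglongrightarrow> (\<integral>\<^sup>+\<omega>. ennreal (1 / total_weight \<omega>) * indicator ?E\<pi> \<omega> \<partial>P)"
        by (rule Lim_transform_eventually[OF nn_integral_inverse_weight_tendsto[OF P sets_P E\<pi>_sets]])
    qed
    then have eq: "emeasure (reweighted P) ?E\<pi> = emeasure (reweighted P) ?E"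
      unfolding E[symmetric] by (simp only: emeasure_reweighted[OF sets_P] E\<pi>_sets E_sets)
    have "emeasure (distr (reweighted P) seq_borel_inf (\<lambda>\<omega> i. \<omega> (\<pi> i))) ?E = emeasure (reweighted P) ?E\<pi>"
      by (subst emeasure_distr[OF perm E_sets]) (simp only: vimage)
    then show "emeasure (distr (reweighted P) seq_borel_inf (\<lambda>\<omega> i. \<omega> (\<pi> i))) ?E = emeasure (reweighted P) ?E"
      by (simp only: eq)
  qed (auto simp: sets_Q intro!: Q.finite_measure_distr measurable_PiM_single')
  then show ?thesis
    by (intro exchangeable_seq.intro exchangeable_seq_axioms.intro Q.prob_space_axioms sets_Q)
qed

text \<open>
  If \<open>N\<close> is the mixing measure of the exchangeable measure \<open>reweighted P\<close>, then the mixing measure of \<open>P\<close>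
  has density \<open>mass P * Z \<mu>\<close> with respect to \<open>N\<close>.  Its total mass is \<open>1\<close> because \<open>P\<close> is a probability
  measure.  Measurability of \<open>\<mu> \<mapsto> weighted_iid w \<mu> A\<close> follows from the same formula, as a quotient of two
  integrals against \<open>\<mu>\<^sup>\<infinity>\<close>.
\<close>

theorem weighted_iid_mixture_of_symmetric:
  assumes P: "prob_space P" and sets_P: "sets P = sets seq_borel_inf"
    and sym: "unweighted_symmetric P"
  shows "weighted_iid_mixture w P"
proof -
  interpret Q: exchangeable_seq "reweighted P" using assms by (rule exchangeable_reweighted)
  obtain N where N: "N \<in> space (prob_algebra (prob_algebra borel))"
    and QN: "reweighted P = N \<bind> (\<lambda>\<mu>. \<Pi>\<^sub>M i\<in>UNIV. \<mu>)"
    using Q.de_Finetti by blast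
  have sets_N [measurable_cong]: "sets N = sets (prob_algebra borel)" using N by (simp add: space_prob_algebra)
  have space_N: "\<mu> \<in> space N \<Longrightarrow> prob_space \<mu> \<and> sets \<mu> = sets borel" for \<mu>
    using sets_eq_imp_space_eq[OF sets_N] by (simp add: space_prob_algebra)
  have iid: "(\<lambda>\<mu>. \<Pi>\<^sub>M i\<in>UNIV. \<mu>) \<in> prob_algebra borel \<rightarrow>\<^sub>M prob_algebra (seq_borel_inf :: (nat \<Rightarrow> 'a) measure)"
    by (rule measurable_PiM_kernel) simp
  note iid' = measurable_prob_algebraD[OF iid]
  have iid_N: "(\<lambda>\<mu>. \<Pi>\<^sub>M i\<in>UNIV. \<mu>) \<in> N \<rightarrow>\<^sub>M subprob_algebra seq_borel_inf" using iid' by simp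
  define Z where "Z \<mu> = (\<integral>\<^sup>+\<omega>. ennreal (total_weight \<omega>) \<partial>(\<Pi>\<^sub>M i\<in>(UNIV::nat set). \<mu>))" for \<mu>
  have [measurable]: "Z \<in> borel_measurable (prob_algebra borel)"
    unfolding Z_def by (rule measurable_compose[OF iid' nn_integral_measurable_subprob_algebra]) measurable
  have Z: "Z \<mu> \<noteq> 0" "Z \<mu> \<noteq> \<top>"
    and int_Z: "A \<in> sets seq_borel_inf \<Longrightarrow>
      (\<integral>\<^sup>+\<omega>. ennreal (total_weight \<omega>) * indicator A \<omega> \<partial>(\<Pi>\<^sub>M i\<in>(UNIV::nat set). \<mu>)) = Z \<mu> * emeasure (weighted_iid w \<mu>) A"
    if "\<mu> \<in> space N" for \<mu> A
    using total_weight_density_iid[of \<mu>] space_N[OF that] by (auto simp: Z_def top_unique)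
  have meas: "(\<lambda>\<mu>. emeasure (weighted_iid w \<mu>) A) \<in> borel_measurable N"
    if A: "A \<in> sets seq_borel_inf" for A
  proof -
    have "(\<lambda>\<mu>. \<integral>\<^sup>+\<omega>. ennreal (total_weight \<omega>) * indicator A \<omega> \<partial>(\<Pi>\<^sub>M i\<in>(UNIV::nat set). \<mu>)) \<in> borel_measurable (prob_algebra borel)"
      by (rule measurable_compose[OF iid' nn_integral_measurable_subprob_algebra])
        (intro borel_measurable_times_ennreal borel_measurable_indicator A, measurable)
    then have "(\<lambda>\<mu>. (\<integral>\<^sup>+\<omega>. ennreal (total_weight \<omega>) * indicator A \<omega> \<partial>(\<Pi>\<^sub>M i\<in>(UNIV::nat set). \<mu>)) / Z \<mu>) \<in> borel_measurable N"
      by measurable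
    moreover have "emeasure (weighted_iid w \<mu>) A = (\<integral>\<^sup>+\<omega>. ennreal (total_weight \<omega>) * indicator A \<omega> \<partial>(\<Pi>\<^sub>M i\<in>(UNIV::nat set). \<mu>)) / Z \<mu>"
      if "\<mu> \<in> space N" for \<mu>
      unfolding int_Z[OF that A] mult.commute[of "Z \<mu>"] using Z[OF that] by (simp add: mult_divide_eq_ennreal)
    ultimately show ?thesis by (subst measurable_cong)
  qed
  define R where "R = density N (\<lambda>\<mu>. mass P * Z \<mu>)"
  have mix: "emeasure P A = (\<integral>\<^sup>+\<mu>. emeasure (weighted_iid w \<mu>) A \<partial>R)"
    if A [measurable]: "A \<in> sets seq_borel_inf" for A
  proof -
    have "emeasure P A = emeasure (density (reweighted P) (\<lambda>\<omega>. mass P * ennreal (total_weight \<omega>))) A"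
      by (simp add: density_reweighted[OF P sets_P])
    also have "\<dots> = (\<integral>\<^sup>+\<omega>. mass P * ennreal (total_weight \<omega>) * indicator A \<omega> \<partial>reweighted P)"
      by (rule emeasure_density) (use A Q.sets_M in \<open>auto intro!: measurable_total_weight cong: measurable_cong_sets\<close>)
    also have "\<dots> = (\<integral>\<^sup>+\<mu>. \<integral>\<^sup>+\<omega>. mass P * ennreal (total_weight \<omega>) * indicator A \<omega> \<partial>(\<Pi>\<^sub>M i\<in>(UNIV::nat set). \<mu>) \<partial>N)"
      unfolding QN by (rule nn_integral_bind[OF _ iid_N]) measurable
    also have "\<dots> = (\<integral>\<^sup>+\<mu>. mass P * Z \<mu> * emeasure (weighted_iid w \<mu>) A \<partial>N)"
    proof (rule nn_integral_cong)
      fix \<mu> assume \<mu>: "\<mu> \<in> space N"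
      have [measurable_cong]: "sets (\<Pi>\<^sub>M i\<in>(UNIV::nat set). \<mu>) = sets seq_borel_inf"
        using space_N[OF \<mu>] by (intro sets_PiM_cong) auto
      have "(\<integral>\<^sup>+\<omega>. mass P * ennreal (total_weight \<omega>) * indicator A \<omega> \<partial>(\<Pi>\<^sub>M i\<in>(UNIV::nat set). \<mu>))
          = mass P * (\<integral>\<^sup>+\<omega>. ennreal (total_weight \<omega>) * indicator A \<omega> \<partial>(\<Pi>\<^sub>M i\<in>(UNIV::nat set). \<mu>))"
        unfolding mult.assoc by (rule nn_integral_cmult) measurable
      then show "(\<integral>\<^sup>+\<omega>. mass P * ennreal (total_weight \<omega>) * indicator A \<omega> \<partial>(\<Pi>\<^sub>M i\<in>(UNIV::nat set). \<mu>))
          = mass P * Z \<mu> * emeasure (weighted_iid w \<mu>) A"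
        by (simp add: int_Z[OF \<mu> A] mult.assoc)
    qed
    also have "\<dots> = (\<integral>\<^sup>+\<mu>. emeasure (weighted_iid w \<mu>) A \<partial>R)"
      unfolding R_def by (rule nn_integral_density[OF _ meas[OF A], symmetric]) measurable
    finally show ?thesis .
  qed
  have "emeasure R (space R) = 1"
  proof -
    have sp: "space P = UNIV" using sets_eq_imp_space_eq[OF sets_P] by (simp add: space_PiM)
    have top: "UNIV \<in> sets (seq_borel_inf :: (nat \<Rightarrow> 'a) measure)"
      using sets.top[of "seq_borel_inf :: (nat \<Rightarrow> 'a) measure"] by (simp add: space_PiM)
    have "emeasure (weighted_iid w \<mu>) UNIV = 1" if "\<mu> \<in> space R" for \<mu>
    proof -
      have \<mu>: "prob_space \<mu>" "sets \<mu> = sets borel" using that space_N by (auto simp: R_def)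
      have "prob_space (weighted_iid w \<mu>)"
        unfolding weighted_iid_def by (intro prob_space_PiM tilt_weight(1) \<mu>)
      moreover have "space (weighted_iid w \<mu>) = UNIV"
        using sets_eq_imp_space_eq[OF sets_weighted_iid[OF \<mu>(2)]] by (simp add: space_PiM)
      ultimately show ?thesis by (metis prob_space.emeasure_space_1)
    qed
    then have "(\<integral>\<^sup>+\<mu>. emeasure (weighted_iid w \<mu>) UNIV \<partial>R) = (\<integral>\<^sup>+\<mu>. 1 \<partial>R)"
      by (rule nn_integral_cong)
    then show ?thesis using mix[OF top] prob_space.emeasure_space_1[OF P] sp by simp
  qed
  then have "prob_space R" by (rule prob_spaceI)
  moreover have "sets R = sets weak_borel"
    using sets_N by (simp add: R_def sets_weak_borel_eq_prob_algebra)
  moreover have "(\<lambda>\<mu>. emeasure (weighted_iid w \<mu>) A) \<in> borel_measurable R" if "A \<in> sets seq_borel_inf" for A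
    using meas[OF that] by (simp add: R_def)
  ultimately show ?thesis
    unfolding weighted_iid_mixture_def using mix sets_P by (intro conjI exI[of _ R] ballI) auto
qed

end

text \<open>
  Exchangeability of the reweighted marginal, pulled back to the sequence space.
\<close>

lemma nn_integral_inverse_weight_permute:
  assumes l: "\<And>i. l i \<in> weights" and exch: "weighted_exchangeable l P" and k: "1 \<le> k"
    and \<pi>: "\<pi> permutes {..<k}" and f: "f \<in> borel_measurable (seq_borel k)"
  shows "(\<integral>\<^sup>+\<omega>. ennreal (1 / (\<Prod>i<k. l i (\<omega> i))) * f (\<lambda>i\<in>{..<k}. \<omega> (\<pi> i)) \<partial>P)
    = (\<integral>\<^sup>+\<omega>. ennreal (1 / (\<Prod>i<k. l i (\<omega> i))) * f (restrict \<omega> {..<k}) \<partial>P)"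
proof -
  have sets_P [measurable_cong]: "sets P = sets seq_borel_inf" using exch by (simp add: weighted_exchangeable_def)
  have [measurable]: "l i \<in> borel_measurable borel" for i using l[of i] by (simp add: weights_def)
  note [measurable] = f
  let ?U = "unweighted l k (marginal k P)"
  have sets_U [measurable_cong]: "sets ?U = sets (seq_borel k)" by (simp add: unweighted_def marginal_def)
  have restr [measurable]: "(\<lambda>x. restrict x {..<k}) \<in> P \<rightarrow>\<^sub>M seq_borel k"
    unfolding measurable_cong_sets[OF sets_P refl] by (rule measurable_restrict_subset) simp
  have perm [measurable]: "(\<lambda>x. \<lambda>i\<in>{..<k}. x (\<pi> i)) \<in> seq_borel k \<rightarrow>\<^sub>M seq_borel k"
    by (rule measurable_restrict, rule measurable_component_singleton)
      (use permutes_in_image[OF \<pi>] in blast)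
  have U: "(\<integral>\<^sup>+x. g x \<partial>?U) = (\<integral>\<^sup>+\<omega>. ennreal (1 / (\<Prod>i<k. l i (\<omega> i))) * g (restrict \<omega> {..<k}) \<partial>P)"
    if [measurable]: "g \<in> borel_measurable (seq_borel k)" for g
    unfolding unweighted_def marginal_def
    by (simp add: nn_integral_density nn_integral_distr)
  have "distr ?U (seq_borel k) (\<lambda>x. \<lambda>i\<in>{..<k}. x (\<pi> i)) = ?U"
    using exch k \<pi> unfolding weighted_exchangeable_def weighted_exchangeable_n_def exchangeable_def by blast
  then have "(\<integral>\<^sup>+x. f x \<partial>?U) = (\<integral>\<^sup>+x. f x \<partial>distr ?U (seq_borel k) (\<lambda>x. \<lambda>i\<in>{..<k}. x (\<pi> i)))" by simp
  also have "\<dots> = (\<integral>\<^sup>+x. f (\<lambda>i\<in>{..<k}. x (\<pi> i)) \<partial>?U)" by (rule nn_integral_distr) measurable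
  finally have "(\<integral>\<^sup>+x. f (\<lambda>i\<in>{..<k}. x (\<pi> i)) \<partial>?U) = (\<integral>\<^sup>+x. f x \<partial>?U)" ..
  moreover have "(\<integral>\<^sup>+x. f (\<lambda>i\<in>{..<k}. x (\<pi> i)) \<partial>?U)
      = (\<integral>\<^sup>+\<omega>. ennreal (1 / (\<Prod>i<k. l i (\<omega> i))) * f (\<lambda>i\<in>{..<k}. \<omega> (\<pi> i)) \<partial>P)"
  proof -
    have "(\<lambda>i\<in>{..<k}. restrict \<omega> {..<k} (\<pi> i)) = (\<lambda>i\<in>{..<k}. \<omega> (\<pi> i))" for \<omega> :: "nat \<Rightarrow> 'a"
      using permutes_in_image[OF \<pi>] by (auto simp: restrict_def fun_eq_iff)
    then show ?thesis by (subst U) (auto intro!: measurable_compose[OF perm f])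
  qed
  ultimately show ?thesis using U[OF f] by simp
qed

theorem corollary3p4:
  fixes l :: "nat \<Rightarrow> 'a::polish_space \<Rightarrow> real"
    and P :: "(nat \<Rightarrow> 'a) measure"
  assumes "\<And>i. l i \<in> weights"
    and "weighted_exchangeable l P"
    and "\<And>i. continuous_on UNIV (l i)"
    and "\<And>i. bounded (range (l i))"
    and "\<And>i. weight_ratio (l i) > 0"
    and "summable (\<lambda>i. 1 - weight_ratio (l i))"
  shows "weighted_iid_mixture l P"
proof -
  have l_meas [measurable]: "l i \<in> borel_measurable borel" and l_pos: "0 < l i x" for i x
    using assms(1)[of i] by (auto simp: weights_def)
  have P: "prob_space P" and sets_P [measurable_cong]: "sets P = sets seq_borel_inf"
    using assms(2) by (auto simp: weighted_exchangeable_def)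
  define S where "S i = (SUP x. l i x)" for i
  define w where "w i x = l i x / S i" for i x
  have above: "bdd_above (range (l i))" and below: "bdd_below (range (l i))" for i
    using assms(4)[of i] by (auto intro: bounded_imp_bdd_above bounded_imp_bdd_below)
  have l_le: "l i x \<le> S i" for i x unfolding S_def by (intro cSUP_upper above) auto
  have S_pos: "0 < S i" for i using l_pos l_le by (rule less_le_trans)
  have "weight_ratio (l i) \<le> w i x" for i x
  proof -
    have "(INF x. l i x) \<le> l i x" by (intro cINF_lower below) auto
    then show ?thesis using S_pos[of i] by (simp add: weight_ratio_def w_def S_def divide_right_mono)
  qed
  then interpret summable_weights w "\<lambda>i. weight_ratio (l i)"
    using assms(5,6) l_le S_pos by unfold_locales (auto simp: w_def[abs_def])
  have partial: "1 / partial_weight k \<omega> = (\<Prod>i<k. S i) * (1 / (\<Prod>i<k. l i (\<omega> i)))" for k \<omega>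
    by (simp add: partial_weight_def w_def prod_dividef)
  have "unweighted_symmetric P"
    unfolding unweighted_symmetric_def
  proof (intro allI impI)
    fix k :: nat and \<pi> J and A :: "nat \<Rightarrow> 'a set"
    assume k: "1 \<le> k" and \<pi>: "\<pi> permutes {..<k}" and J: "J \<subseteq> {..<k}" and A: "\<forall>i. A i \<in> sets borel"
    have "finite J" using J finite_subset by blast
    let ?B = "{x\<in>space (seq_borel k). \<forall>i\<in>J. x i \<in> A i}"
    have "?B \<in> sets (seq_borel k)"
      using J A \<open>finite J\<close> by (intro sets.sets_Collect_finite_All sets_Collect_single') auto
    then have f: "(\<lambda>x. ennreal (\<Prod>i<k. S i) * indicator ?B x) \<in> borel_measurable (seq_borel k)"
      by measurable
    have scale: "ennreal (1 / partial_weight k \<omega>) * t = ennreal (1 / (\<Prod>i<k. l i (\<omega> i))) * (ennreal (\<Prod>i<k. S i) * t)" for \<omega> t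
    proof -
      have "ennreal (1 / partial_weight k \<omega>) = ennreal (1 / (\<Prod>i<k. l i (\<omega> i))) * ennreal (\<Prod>i<k. S i)"
        unfolding partial using S_pos l_pos by (subst ennreal_mult[symmetric]) (auto simp: prod_nonneg less_imp_le)
      then show ?thesis by (simp add: mult.assoc)
    qed
    have ind: "indicator ?B (\<lambda>i\<in>{..<k}. \<omega> (\<rho> i)) = (indicator {\<omega>. \<forall>i\<in>J. \<omega> (\<rho> i) \<in> A i} \<omega> :: ennreal)" for \<omega> \<rho>
      using J by (auto simp: indicator_def space_PiM)
    show "(\<integral>\<^sup>+\<omega>. ennreal (1 / partial_weight k \<omega>) * indicator {\<omega>. \<forall>i\<in>J. \<omega> (\<pi> i) \<in> A i} \<omega> \<partial>P) =
     (\<integral>\<^sup>+\<omega>. ennreal (1 / partial_weight k \<omega>) * indicator {\<omega>. \<forall>i\<in>J. \<omega> i \<in> A i} \<omega> \<partial>P)"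
      unfolding scale using nn_integral_inverse_weight_permute[OF assms(1,2) k \<pi> f] ind[of _ \<pi>] ind[of _ "\<lambda>i. i"] by simp
  qed
  then have "weighted_iid_mixture w P" by (rule weighted_iid_mixture_of_symmetric[OF P sets_P])
  moreover have "tilt (w i) \<mu> = tilt (l i) \<mu>" for i \<mu>
    using S_pos[of i] by (simp add: tilt_def w_def)
  ultimately show ?thesis by (simp add: weighted_iid_mixture_def weighted_iid_def)
qed

end
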